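(* Let $K=\{p_1,p_2,\dots,p_n\}$ be a finite set in a normed plane $\mathbb{M}^2=(\mathbb{R}^2,\|\cdot\|)$ and let $\lambda\geq\lambda_K$. If $\mathbb{M}^2$ is strictly convex or $\lambda\geq\operatorname{diam}(K)$, then every arc of the boundary of $\operatorname{bi}(K,\lambda)$ has a vertex of $\operatorname{bh}(K,\lambda)$ as center. Moreover, every vertex of $\operatorname{bi}(K,\lambda)$ is the center of an arc belonging to the boundary of $\operatorname{bh}(K,\lambda)$.
   Context: $B(x,\lambda)$ is the closed disc $\{y:\|y-x\|\le\lambda\}$ and $S(x,\lambda)$ its boundary circle ($\lambda>0$). The $\lambda$-ball hull of $K$ is $\operatorname{bh}(K,\lambda)=\bigcap_{K\subset B(x,\lambda)}B(x,\lambda)$; the $\lambda$-ball intersection of $K$ is $\operatorname{bi}(K,\lambda)=\bigcap_{x\in K}B(x,\lambda)$. The circumradius $\lambda_K$ is the smallest number such that $K$ is contained in a disc of radius $\lambda_K$; $\operatorname{diam}(K)=\max\{\|x-y\|:x,y\in K\}$. Under the stated hypotheses the boundary of $\operatorname{bh}(K,\lambda)$ consists of circular arcs of radius $\lambda$ whose endpoints are points of $K$; the endpoints of these arcs are called the vertices of $\operatorname{bh}(K,\lambda)$. The boundary of $\operatorname{bi}(K,\lambda)$ consists of circular arcs of radius $\lambda$ with centers belonging to $K$; the endpoints of these arcs are called the vertices of $\operatorname{bi}(K,\lambda)$. The center of an arc contained in $S(x,\lambda)$ is $x$. The plane is strictly convex if its unit circle contains no non-degenerate segment. *)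

theory Defs
  imports "HOL-Analysis.Analysis"
begin

text \<open>
  A normed plane is a type of class \<open>real_normed_vector\<close> whose dimension is 2, so that
  \<open>cball\<close>, \<open>sphere\<close>, \<open>diameter\<close> and \<open>frontier\<close> all refer to the given, not necessarily
  Euclidean, norm.
\<close>

definition strictly_convex_space :: "'a::real_normed_vector itself \<Rightarrow> bool" where
  "strictly_convex_space _ \<longleftrightarrow>
     \<not> (\<exists>a b :: 'a. a \<noteq> b \<and> closed_segment a b \<subseteq> sphere 0 1)"

definition ball_hull :: "'a::real_normed_vector set \<Rightarrow> real \<Rightarrow> 'a set" where
  "ball_hull K r = \<Inter> {cball x r |x. K \<subseteq> cball x r}"

definition ball_inter :: "'a::real_normed_vector set \<Rightarrow> real \<Rightarrow> 'a set" where
  "ball_inter K r = (\<Inter>x\<in>K. cball x r)"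

text \<open>For nonempty \<open>K\<close> only radii \<open>s \<ge> 0\<close> contribute, as \<open>cball x s\<close> is empty for \<open>s < 0\<close>.\<close>

definition circumradius :: "'a::real_normed_vector set \<Rightarrow> real" where
  "circumradius K = Inf {s. \<exists>x. K \<subseteq> cball x s}"

text \<open>A single point is a degenerate arc and its own endpoint; a full circle has no endpoints.\<close>

definition endpoints :: "'a::real_normed_vector set \<Rightarrow> 'a set" where
  "endpoints A = {a. A = {a} \<or>
     (\<exists>g. arc g \<and> path_image g = A \<and> (a = pathstart g \<or> a = pathfinish g))}"

text \<open>
  The arcs with center \<open>c\<close> forming the boundary of the ball intersection: the maximal connected
  pieces of the boundary lying on the circle around \<open>c \<in> K\<close>. Such a piece is a proper arc, a
  single point (e.g. if the ball intersection is a point) or, if \<open>K = {c}\<close>, the full circle.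
\<close>

definition bi_arcs :: "'a::real_normed_vector set \<Rightarrow> real \<Rightarrow> 'a \<Rightarrow> 'a set set" where
  "bi_arcs K r c =
     (if c \<in> K then components (sphere c r \<inter> frontier (ball_inter K r)) else {})"

definition bi_vertices :: "'a::real_normed_vector set \<Rightarrow> real \<Rightarrow> 'a set" where
  "bi_vertices K r = (\<Union>c. \<Union>A\<in>bi_arcs K r c. endpoints A)"

text \<open>
  Pieces of the boundary of the ball hull on the circle around \<open>x\<close>, with both endpoints in \<open>K\<close>.
  Only circles bounding one of the discs whose intersection is the ball hull are admitted; without
  strict convexity other circles can share a segment with the boundary. A single point is
  an arc only if it is the whole boundary, which happens exactly for one-point sets \<open>K\<close>.
\<close>

definition bh_subarcs :: "'a::real_normed_vector set \<Rightarrow> real \<Rightarrow> 'a \<Rightarrow> 'a set set" where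
  "bh_subarcs K r x = {A. K \<subseteq> cball x r \<and> A \<subseteq> sphere x r \<inter> frontier (ball_hull K r) \<and>
     ((\<exists>g. arc g \<and> path_image g = A \<and> pathstart g \<in> K \<and> pathfinish g \<in> K) \<or>
      (\<exists>p\<in>K. A = {p} \<and> frontier (ball_hull K r) = {p}))}"

text \<open>
  The arcs of the ball hull with center \<open>x\<close> are the maximal ones. Without strict convexity
  the connected pieces of \<open>sphere x r \<inter> frontier (ball_hull K r)\<close> need not end in points of \<open>K\<close>
  (for the maximum norm the hull is a box whose corners may lie outside \<open>K\<close>), and if the hull
  is a full disc the piece is a full circle; hence maximality among arcs that end in \<open>K\<close>.
\<close>

definition bh_arcs :: "'a::real_normed_vector set \<Rightarrow> real \<Rightarrow> 'a \<Rightarrow> 'a set set" where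
  "bh_arcs K r x = {A \<in> bh_subarcs K r x. \<forall>B\<in>bh_subarcs K r x. A \<subseteq> B \<longrightarrow> B = A}"

definition bh_vertices :: "'a::real_normed_vector set \<Rightarrow> real \<Rightarrow> 'a set" where
  "bh_vertices K r = (\<Union>x. \<Union>A\<in>bh_arcs K r x. endpoints A)"

end

theory Submission
  imports Defs
begin

text \<open>
  Write \<open>X\<close> for the ball intersection and \<open>H\<close> for the ball hull of \<open>K\<close>. A point \<open>x\<close> lies in \<open>X\<close>
  exactly if \<open>K \<subseteq> cball x r\<close>, and then \<open>H \<subseteq> cball x r\<close>; so a point of \<open>H\<close> at distance \<open>r\<close> from some
  \<open>x \<in> X\<close> is a boundary point of \<open>H\<close>. This duality drives both halves.
  
  Vertices of \<open>X\<close> are centers. An end \<open>x\<close> of an arc of \<open>X\<close> with center \<open>c\<close> lies on a second circle around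
  some \<open>c' \<in> K\<close>, since otherwise \<open>X\<close> would agree with \<open>cball c r\<close> near \<open>x\<close> and the arc would continue
  beyond \<open>x\<close> (\<open>bi_arc_end_on_two_circles\<close>). So \<open>c\<close> and \<open>c'\<close> lie on \<open>sphere x r\<close>. If \<open>dist c c' < 2 * r\<close>,
  the minor arc between them lies in every disc of radius \<open>r\<close> containing \<open>c\<close> and \<open>c'\<close>
  (\<open>minor_arc_in_disc\<close>, the main geometric input), hence in \<open>H\<close>. If \<open>c\<close> and \<open>c'\<close> are antipodal, then
  \<open>r < diameter K\<close>, the plane is strictly convex, \<open>X\<close> consists of \<open>x\<close> alone, \<open>H\<close> is the
  disc around \<open>x\<close>, and every arc of the circle will do. Only finitely many arcs of a circle end in \<open>K\<close>,
  so this arc extends to a maximal one.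
  
  Arcs of \<open>X\<close> are centered at vertices of \<open>H\<close>. A degenerate arc \<open>{a}\<close> is settled by the first half: the
  ends of an arc of \<open>H\<close> with center \<open>a\<close> are vertices at distance \<open>r\<close> from \<open>a\<close>. Let the arc \<open>A\<close> with center
  \<open>c\<close> have distinct ends \<open>x1\<close>, \<open>x2\<close>, and suppose that \<open>c\<close> is not a vertex. Then \<open>c\<close> is an inner point
  of a maximal arc of \<open>H\<close> with center \<open>x2\<close>. A functional that attains its norm at \<open>c - x1\<close> is bounded on
  \<open>H\<close> by its value at \<open>c\<close>; as an inner point of the arc is a local maximum on \<open>sphere x2 r\<close>, the functional
  attains its norm at \<open>c - x2\<close> up to a sign, and the wrong sign can be excluded
  (\<open>support_functional_shared_by_arc_end\<close>). So the circle around \<open>c\<close>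
  contains the segment from \<open>x1\<close> to \<open>x2\<close>, which must be \<open>A\<close>. Now any point of \<open>K\<close> on the line through
  \<open>c\<close> parallel to \<open>A\<close> is at distance \<open>r\<close> from all of \<open>A\<close>, and the last such point in the direction from
  \<open>x1\<close> to \<open>x2\<close> is a vertex (\<open>vertex_on_supporting_line\<close>).
  
  Circles are handled by angles: a linear bijection with the complex plane turns each circle into a
  continuous image of the real line, along which paths can be lifted.
\<close>

section \<open>Coordinates and angles in a normed plane\<close>

text \<open>
  A basis of two vectors identifies the plane with the complex numbers. No relation between the norms
  is claimed; the identification only serves to speak about angles and to borrow theorems about
  Euclidean spaces.
\<close>
lemma plane_coordinates_exist:
  assumes "dim (UNIV :: 'a::real_normed_vector set) = 2"
  shows "\<exists>\<phi> :: complex \<Rightarrow> 'a. linear \<phi> \<and> bij \<phi>"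
proof -
  obtain B :: "'a set" where B: "independent B" "span B = UNIV" "card B = 2"
    using basis_exists[of "UNIV :: 'a set"] assms by (metis top.extremum_uniqueI)
  then obtain b1 b2 where b: "B = {b1, b2}" "b1 \<noteq> b2"
    by (meson card_2_iff)
  define \<phi> where "\<phi> z = Re z *\<^sub>R b1 + Im z *\<^sub>R b2" for z
  have "linear \<phi>"
    by (rule linearI) (auto simp: \<phi>_def algebra_simps)
  have "inj \<phi>"
  proof -
    have "z = 0" if "\<phi> z = 0" for z
    proof -
      have *: "\<forall>u. (\<Sum>v\<in>{b1,b2}. u v *\<^sub>R v) = 0 \<longrightarrow> (\<forall>v\<in>{b1,b2}. u v = 0)"
        using B(1) b dependent_finite[of "{b1,b2}"] by auto
      have "(\<Sum>v\<in>{b1,b2}. (\<lambda>v. if v = b1 then Re z else Im z) v *\<^sub>R v) = 0"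
        using that b by (simp add: \<phi>_def)
      with spec[OF *, of "\<lambda>v. if v = b1 then Re z else Im z"]
      have "\<forall>v\<in>{b1,b2}. (\<lambda>v. if v = b1 then Re z else Im z) v = 0" by simp
      then show ?thesis using b by (auto simp: complex_eq_iff)
    qed
    with \<open>linear \<phi>\<close> show ?thesis
      by (simp add: linear_injective_0)
  qed
  moreover have "surj \<phi>"
  proof -
    have "y \<in> range \<phi>" for y
    proof -
      have "y \<in> span {b1, b2}" using B(2) b by auto
      then obtain s t where "y = s *\<^sub>R b1 + t *\<^sub>R b2"
        by (auto simp: span_breakdown_eq algebra_simps)
      then have "y = \<phi> (Complex s t)" by (simp add: \<phi>_def)
      then show ?thesis by blast
    qed
    then show ?thesis by auto
  qed
  ultimately show ?thesis using \<open>linear \<phi>\<close> by (auto simp: bij_def)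
qed

locale coordinatized_plane =
  fixes \<phi> :: "complex \<Rightarrow> 'a::real_normed_vector"
  assumes lin: "linear \<phi>" and bij: "bij \<phi>"
begin

lemma \<phi>_inverse: "\<phi> (inv \<phi> v) = v" "inv \<phi> (\<phi> z) = z"
  using bij by (simp_all add: bij_def surj_f_inv_f)

lemma \<phi>_eq_0: "\<phi> z = 0 \<longleftrightarrow> z = 0"
  using \<phi>_inverse(2)[of z] \<phi>_inverse(2)[of 0] linear_0[OF lin] by auto

lemma continuous_\<phi>: "continuous_on S \<phi>"
  using lin by (simp add: linear_continuous_on linear_conv_bounded_linear)

lemma linear_inv: "linear (inv \<phi>)"
proof (rule linearI)
  show "inv \<phi> (a + b) = inv \<phi> a + inv \<phi> b" for a b
    using linear_add[OF lin, of "inv \<phi> a" "inv \<phi> b"] \<phi>_inverse(2)[of "inv \<phi> a + inv \<phi> b"]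
    by (simp add: \<phi>_inverse(1))
  show "inv \<phi> (r *\<^sub>R b) = r *\<^sub>R inv \<phi> b" for r b
    using linear_scale[OF lin, of r "inv \<phi> b"] \<phi>_inverse(2)[of "r *\<^sub>R inv \<phi> b"]
    by (simp add: \<phi>_inverse(1))
qed

text \<open>
  On the compact unit circle of the complex plane the continuous function \<open>\<lambda>z. norm (\<phi> z)\<close> has
  a positive minimum, and its reciprocal bounds the inverse.
\<close>
lemma bounded_linear_inv: "bounded_linear (inv \<phi>)"
proof -
  have "compact ((\<lambda>z. norm (\<phi> z)) ` sphere 0 1)"
    by (intro compact_continuous_image continuous_intros continuous_\<phi>) auto
  moreover have "(1::complex) \<in> sphere 0 1" by simp
  ultimately obtain z0 where z0: "z0 \<in> sphere 0 1" "\<And>z. z \<in> sphere 0 1 \<Longrightarrow> norm (\<phi> z0) \<le> norm (\<phi> z)"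
    using compact_attains_inf[of "(\<lambda>z. norm (\<phi> z)) ` sphere 0 1"] by auto
  have m: "norm (\<phi> z0) > 0"
    using z0(1) by (auto simp: \<phi>_eq_0)
  have "norm (inv \<phi> v) \<le> norm v * (1 / norm (\<phi> z0))" for v
  proof (cases "inv \<phi> v = 0")
    case False
    define z where "z = inv \<phi> v"
    have "norm (\<phi> z0) \<le> norm (\<phi> (z /\<^sub>R norm z))"
      using False by (intro z0(2)) (simp add: z_def)
    also have "\<phi> (z /\<^sub>R norm z) = v /\<^sub>R norm z"
      using lin by (simp add: linear_scale z_def \<phi>_inverse)
    finally show ?thesis
      using False m by (simp add: z_def field_simps)
  qed auto
  then show ?thesis
    using linear_inv by (intro bounded_linear_intro[where K = "1 / norm (\<phi> z0)"]) (simp_all add: linear_add linear_scale)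
qed

lemma continuous_inv: "continuous_on S f \<Longrightarrow> continuous_on S (\<lambda>x. inv \<phi> (f x))"
  by (rule bounded_linear.continuous_on[OF bounded_linear_inv])

text \<open>
  The point of \<open>sphere x r\<close> in the direction that has angle \<open>\<theta>\<close> in the coordinates.
\<close>
definition circ :: "'a \<Rightarrow> real \<Rightarrow> real \<Rightarrow> 'a" where
  "circ x r \<theta> = x + r *\<^sub>R sgn (\<phi> (cis \<theta>))"

lemma norm_sgn_\<phi>: "norm (sgn (\<phi> (cis \<theta>))) = 1"
  by (simp add: norm_sgn \<phi>_eq_0)

lemma continuous_circ: "continuous_on S (circ x r)"
  unfolding circ_def sgn_div_norm
  by (intro continuous_intros continuous_on_compose2[OF continuous_\<phi>[of UNIV]]) (auto simp: \<phi>_eq_0)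

lemma circ_in_sphere: "r > 0 \<Longrightarrow> circ x r \<theta> \<in> sphere x r"
  by (simp add: circ_def dist_norm norm_sgn_\<phi>)

lemma circ_eq_polar:
  assumes "y \<in> sphere x r" "r > 0" "y - x = \<phi> (s *\<^sub>R cis \<theta>)" "s > 0"
  shows "y = circ x r \<theta>"
proof -
  have "y - x = r *\<^sub>R sgn (y - x)"
    using assms(1,2) by (auto simp: sgn_div_norm dist_norm norm_minus_commute)
  also have "sgn (y - x) = sgn (\<phi> (cis \<theta>))"
    using assms(3,4) lin by (simp only: linear_scale sgn_scaleR) simp
  finally show ?thesis by (simp add: circ_def algebra_simps)
qed

lemma circ_eq_iff:
  assumes "r > 0"
  shows "circ x r a = circ x r b \<longleftrightarrow> (\<exists>n::int. a = b + 2 * pi * n)"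
proof
  assume "circ x r a = circ x r b"
  then have "sgn (\<phi> (cis a)) = sgn (\<phi> (cis b))" using assms by (simp add: circ_def)
  then have "\<phi> (cis a /\<^sub>R norm (\<phi> (cis a))) = \<phi> (cis b /\<^sub>R norm (\<phi> (cis b)))"
    using lin by (simp add: sgn_div_norm linear_scale)
  then have e: "cis a /\<^sub>R norm (\<phi> (cis a)) = cis b /\<^sub>R norm (\<phi> (cis b))"
    using \<phi>_inverse(2) by metis
  then have "norm (cis a /\<^sub>R norm (\<phi> (cis a))) = norm (cis b /\<^sub>R norm (\<phi> (cis b)))" by simp
  then have "norm (\<phi> (cis a)) = norm (\<phi> (cis b))" by simp
  with e have "cis a = cis b" by (simp add: \<phi>_eq_0)
  then show "\<exists>n::int. a = b + 2 * pi * n"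
    using sin_cos_eq_iff[of a b] by (auto simp: complex_eq_iff)
next
  assume "\<exists>n::int. a = b + 2 * pi * n"
  then have "cis a = cis b"
    using sin_cos_eq_iff[of a b] by (auto simp: complex_eq_iff)
  then show "circ x r a = circ x r b" by (simp add: circ_def)
qed

lemma circ_inj_near:
  assumes "r > 0" "circ x r a = circ x r b" "\<bar>a - b\<bar> < 2 * pi"
  shows "a = b"
proof -
  obtain n :: int where n: "a = b + 2 * pi * n" using circ_eq_iff assms by blast
  with assms(3) have "\<bar>real_of_int n\<bar> * (2 * pi) < 1 * (2 * pi)"
    by (simp add: abs_mult mult.commute)
  then have "\<bar>real_of_int n\<bar> < 1" by (simp add: mult_less_cancel_right)
  then have "n = 0" by linarith
  then show ?thesis using n by simp
qed

lemma circ_angle: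
  assumes "y \<in> sphere x r" "r > 0"
  obtains \<theta> where "t \<le> \<theta>" "\<theta> < t + 2 * pi" "y = circ x r \<theta>"
proof -
  define z where "z = inv \<phi> (y - x)"
  have "y - x \<noteq> 0" using assms by auto
  then have z: "z \<noteq> 0" "y - x = \<phi> z"
    using \<phi>_inverse(1)[of "y - x"] \<phi>_eq_0[of z] by (auto simp: z_def)
  have "z = norm z *\<^sub>R cis (Arg z)"
    using z(1) by (simp add: cis_Arg sgn_div_norm)
  then have y: "y = circ x r (Arg z)"
    using circ_eq_polar[OF assms, of "norm z"] z by simp
  define n where "n = \<lfloor>(Arg z - t) / (2 * pi)\<rfloor>"
  have n: "of_int n \<le> (Arg z - t) / (2 * pi)" "(Arg z - t) / (2 * pi) < of_int n + 1"
    unfolding n_def by linarith+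
  have "circ x r (Arg z - 2 * pi * n) = circ x r (Arg z)"
    unfolding circ_eq_iff[OF assms(2)] by (intro exI[of _ "-n"]) simp
  moreover have "t \<le> Arg z - 2 * pi * n" "Arg z - 2 * pi * n < t + 2 * pi"
    using n pi_gt_zero by (auto simp: field_simps)
  ultimately show ?thesis using that y by metis
qed

text \<open>
  The universal covering of the circle, in the form needed here: after translation to the origin, a
  path on the circle has a continuous complex logarithm, whose imaginary part is an angle. Adding a
  multiple of \<open>2 * pi\<close> gives the prescribed initial angle.
\<close>
lemma circ_lift:
  assumes "path h" "path_image h \<subseteq> sphere x r" "r > 0" "h 0 = circ x r \<theta>"
  obtains \<psi> where "continuous_on {0..1} \<psi>" "\<psi> 0 = \<theta>" "\<And>t. t \<in> {0..1} \<Longrightarrow> h t = circ x r (\<psi> t)"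
proof -
  have h: "h t \<in> sphere x r" if "t \<in> {0..1}" for t
    using assms(2) that unfolding path_image_def by blast
  have "continuous_on {0..1} (\<lambda>t. inv \<phi> (h t - x))"
    using assms(1) by (intro continuous_inv continuous_intros) (auto simp: path_def)
  moreover have nz: "inv \<phi> (h t - x) \<noteq> 0" if "t \<in> {0..1}" for t
  proof
    assume "inv \<phi> (h t - x) = 0"
    then have "h t - x = 0" using \<phi>_inverse(1)[of "h t - x"] \<phi>_eq_0[of 0] by simp
    then show False using h[OF that] assms(3) by auto
  qed
  ultimately obtain F where F: "continuous_on {0..1} F" "\<And>t. t \<in> {0..1} \<Longrightarrow> inv \<phi> (h t - x) = exp (F t)"
    using continuous_logarithm_on_contractible[of "{0..1}" "\<lambda>t. inv \<phi> (h t - x)"]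
      convex_imp_contractible[of "{0..1::real}"] by auto
  have hF: "h t = circ x r (Im (F t))" if "t \<in> {0..1}" for t
  proof (rule circ_eq_polar[OF h[OF that] assms(3), of "exp (Re (F t))"])
    have "h t - x = \<phi> (exp (F t))" using F(2)[OF that] \<phi>_inverse(1)[of "h t - x"] by simp
    then show "h t - x = \<phi> (exp (Re (F t)) *\<^sub>R cis (Im (F t)))"
      by (simp add: exp_eq_polar scaleR_conv_of_real)
  qed auto
  have "circ x r (Im (F 0)) = circ x r \<theta>" using hF[of 0] assms(4) by simp
  then obtain n :: int where n: "Im (F 0) = \<theta> + 2 * pi * n" using circ_eq_iff assms(3) by blast
  show ?thesis
  proof (rule that[of "\<lambda>t. Im (F t) - 2 * pi * n"])
    show "continuous_on {0..1} (\<lambda>t. Im (F t) - 2 * pi * n)"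
      by (intro continuous_intros F)
    show "h t = circ x r (Im (F t) - 2 * pi * n)" if "t \<in> {0..1}" for t
    proof -
      have "circ x r (Im (F t) - 2 * pi * n) = circ x r (Im (F t))"
        unfolding circ_eq_iff[OF assms(3)] by (intro exI[of _ "-n"]) simp
      then show ?thesis using hF[OF that] by simp
    qed
  qed (use n in auto)
qed

text \<open>
  The angle of an injective path is an injective continuous function, hence monotone, and it covers an
  interval shorter than a full turn.
\<close>
lemma arc_in_sphere_angles:
  assumes "arc g" "path_image g \<subseteq> sphere x r" "r > 0"
  obtains \<alpha> \<beta> where "\<alpha> < \<beta>" "\<beta> < \<alpha> + 2 * pi" "path_image g = circ x r ` {\<alpha>..\<beta>}"
    "{circ x r \<alpha>, circ x r \<beta>} = {pathstart g, pathfinish g}"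
proof -
  have "path g" using assms(1) by (simp add: arc_imp_path)
  have "pathstart g \<in> sphere x r" using assms(2) by (auto simp: pathstart_in_path_image)
  then obtain \<theta> where "g 0 = circ x r \<theta>"
    unfolding pathstart_def by (rule circ_angle[OF _ assms(3)])
  from circ_lift[OF \<open>path g\<close> assms(2,3) this]
  \<comment> \<open>the arc may run clockwise, so the angles of its ends are sorted below\<close>
  obtain \<psi> where \<psi>: "continuous_on {0..1} \<psi>" "\<And>t. t \<in> {0..1} \<Longrightarrow> g t = circ x r (\<psi> t)" by blast
  have inj: "inj_on \<psi> {0..1}"
  proof (rule inj_onI)
    fix s t assume st: "s \<in> {0..1}" "t \<in> {0..1}" "\<psi> s = \<psi> t"
    then have "g s = g t" using \<psi>(2) by simp
    then show "s = t" using assms(1) st(1,2) unfolding arc_def by (blast dest: inj_onD)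
  qed
  define \<alpha> where "\<alpha> = min (\<psi> 0) (\<psi> 1)"
  define \<beta> where "\<beta> = max (\<psi> 0) (\<psi> 1)"
  have ne: "\<psi> 0 \<noteq> \<psi> 1" using inj_onD[OF inj, of 0 1] by auto
  have sub: "\<psi> ` {0..1} \<subseteq> {\<alpha>..\<beta>}"
  proof clarify
    fix t :: real assume t: "t \<in> {0..1}"
    show "\<psi> t \<in> {\<alpha>..\<beta>}"
    proof (cases "t = 0 \<or> t = 1")
      case False
      then show ?thesis
        using continuous_inj_imp_mono[of 0 t 1 \<psi>, OF _ _ \<psi>(1) inj] t
        by (auto simp: \<alpha>_def \<beta>_def)
    qed (auto simp: \<alpha>_def \<beta>_def)
  qed
  have "connected (\<psi> ` {0..1})"
    using \<psi>(1) by (intro connected_continuous_image) auto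
  then have "{\<alpha>..\<beta>} \<subseteq> \<psi> ` {0..1}"
    using connected_contains_Icc[of "\<psi> ` {0..1}" \<alpha> \<beta>] by (auto simp: \<alpha>_def \<beta>_def min_def max_def)
  with sub have im: "\<psi> ` {0..1} = {\<alpha>..\<beta>}" by blast
  have pim: "path_image g = circ x r ` {\<alpha>..\<beta>}"
    unfolding path_image_def im[symmetric] image_image using \<psi>(2) by (auto simp: image_iff)
  have "\<beta> < \<alpha> + 2 * pi"
  proof (rule ccontr)
    assume "\<not> ?thesis"
    then have "\<alpha> + 2 * pi \<in> {\<alpha>..\<beta>}" "\<alpha> \<in> {\<alpha>..\<beta>}"
      unfolding atLeastAtMost_iff using pi_gt_zero by linarith+
    then obtain s t where st: "s \<in> {0..1}" "t \<in> {0..1}" "\<psi> s = \<alpha> + 2 * pi" "\<psi> t = \<alpha>"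
      unfolding im[symmetric] by (metis imageE)
    have "circ x r (\<alpha> + 2 * pi) = circ x r \<alpha>"
      unfolding circ_eq_iff[OF assms(3)] by (intro exI[of _ 1]) simp
    then have "g s = g t" using st \<psi>(2) by simp
    then have "s = t" using assms(1) st by (auto simp: arc_def inj_on_def)
    then show False using st pi_gt_zero by simp
  qed
  moreover have "{circ x r \<alpha>, circ x r \<beta>} = {pathstart g, pathfinish g}"
    using \<psi>(2)[of 0] \<psi>(2)[of 1] by (auto simp: \<alpha>_def \<beta>_def min_def max_def pathstart_def pathfinish_def)
  moreover have "\<alpha> < \<beta>" using ne by (auto simp: \<alpha>_def \<beta>_def)
  ultimately show ?thesis using that pim by blast
qed

lemma arc_circ:
  assumes "r > 0" "a \<noteq> b" "\<bar>a - b\<bar> < 2 * pi"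
  shows "arc (circ x r \<circ> linepath a b)"
  unfolding arc_def
proof
  show "path (circ x r \<circ> linepath a b)"
    by (intro path_continuous_image continuous_circ) auto
  show "inj_on (circ x r \<circ> linepath a b) {0..1}"
  proof (rule comp_inj_on)
    show "inj_on (linepath a b) {0..1}" using assms(2) by (simp add: inj_on_linepath)
    show "inj_on (circ x r) (linepath a b ` {0..1})"
    proof (rule inj_onI)
      fix s t assume st: "s \<in> linepath a b ` {0..1}" "t \<in> linepath a b ` {0..1}" "circ x r s = circ x r t"
      then have "s \<in> closed_segment a b" "t \<in> closed_segment a b" by (simp_all add: linepath_image_01)
      then have "\<bar>s - t\<bar> \<le> \<bar>a - b\<bar>" by (auto simp: closed_segment_eq_real_ivl split: if_splits)
      then show "s = t" using circ_inj_near[OF assms(1) st(3)] assms(3) by linarith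
    qed
  qed
qed

text \<open>
  A path on a circle can leave an arc of that circle only through one of its ends: the angle along the
  path starts in the interval of angles of the arc and finishes outside of it. This replaces all
  arguments about points following or preceding each other on a circle.
\<close>
lemma path_meets_end_of_arc:
  fixes x :: 'a
  assumes "arc g" "path_image g \<subseteq> sphere x r" "r > 0"
    and "path h" "path_image h \<subseteq> sphere x r"
    and "h 0 \<in> path_image g" "h 1 \<notin> path_image g"
  obtains t where "t \<in> {0..1}" "h t \<in> {pathstart g, pathfinish g}"
proof -
  obtain \<alpha> \<beta> where ab: "path_image g = circ x r ` {\<alpha>..\<beta>}"
    "{circ x r \<alpha>, circ x r \<beta>} = {pathstart g, pathfinish g}"
    by (rule arc_in_sphere_angles[OF assms(1-3)])
  obtain \<theta> where \<theta>: "\<theta> \<in> {\<alpha>..\<beta>}" "h 0 = circ x r \<theta>" using assms(6) ab by auto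
  obtain \<psi> where \<psi>: "continuous_on {0..1} \<psi>" "\<psi> 0 = \<theta>" "\<And>t. t \<in> {0..1} \<Longrightarrow> h t = circ x r (\<psi> t)"
    using circ_lift[OF assms(4,5,3) \<theta>(2)] by blast
  have "\<psi> 1 \<notin> {\<alpha>..\<beta>}" using assms(7) \<psi>(3)[of 1] ab(1) by auto
  then consider "\<psi> 1 < \<alpha>" | "\<psi> 1 > \<beta>" by force
  then show ?thesis
  proof cases
    case 1
    then obtain t where "0 \<le> t" "t \<le> 1" "\<psi> t = \<alpha>"
      using IVT2'[of \<psi> 1 \<alpha> 0] \<theta> \<psi> by auto
    then have "h t = circ x r \<alpha>" using \<psi>(3)[of t] by simp
    then have "h t \<in> {pathstart g, pathfinish g}" unfolding ab(2)[symmetric] by simp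
    then show ?thesis using that[of t] \<open>0 \<le> t\<close> \<open>t \<le> 1\<close> by auto
  next
    case 2
    then obtain t where "0 \<le> t" "t \<le> 1" "\<psi> t = \<beta>"
      using IVT'[of \<psi> 0 \<beta> 1] \<theta> \<psi> by auto
    then have "h t = circ x r \<beta>" using \<psi>(3)[of t] by simp
    then have "h t \<in> {pathstart g, pathfinish g}" unfolding ab(2)[symmetric] by simp
    then show ?thesis using that[of t] \<open>0 \<le> t\<close> \<open>t \<le> 1\<close> by auto
  qed
qed

text \<open>
  After a shift by full turns, an arc is given by two angles in \<open>{0..<4 * pi}\<close>, and only finitely many
  such angles belong to points of the finite set. This makes maximal arcs available.
\<close>
lemma finite_arcs_in_sphere:
  fixes x :: 'a
  assumes "r > 0" "finite K"
  shows "finite {A. A \<subseteq> sphere x r \<and> (\<exists>g. arc g \<and> path_image g = A \<and> pathstart g \<in> K \<and> pathfinish g \<in> K)}"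
proof -
  have fin: "finite (circ x r -` K \<inter> {t..<t + 2 * pi})" for t
    by (intro finite_vimage_IntI assms inj_onI circ_inj_near[OF assms(1), of x]) auto
  define T where "T = circ x r -` K \<inter> {0..<2 * pi} \<union> circ x r -` K \<inter> {2 * pi..<2 * pi + 2 * pi}"
  have "finite T" unfolding T_def using fin[of 0] fin[of "2 * pi"] by simp
  have "A \<in> (\<lambda>(\<alpha>, \<beta>). circ x r ` {\<alpha>..\<beta>}) ` (T \<times> T)"
    if g: "path_image g \<subseteq> sphere x r" "arc g" "path_image g = A" "pathstart g \<in> K" "pathfinish g \<in> K" for A g
  proof -
    obtain \<alpha> \<beta> where ab: "\<alpha> < \<beta>" "\<beta> < \<alpha> + 2 * pi" "path_image g = circ x r ` {\<alpha>..\<beta>}"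
      "{circ x r \<alpha>, circ x r \<beta>} = {pathstart g, pathfinish g}"
      by (rule arc_in_sphere_angles[OF g(2,1) assms(1)])
    define n where "n = \<lfloor>\<alpha> / (2 * pi)\<rfloor>"
    define s where "s = 2 * pi * of_int n"
    have "of_int n \<le> \<alpha> / (2 * pi)" "\<alpha> / (2 * pi) < of_int n + 1"
      unfolding n_def by linarith+
    then have s: "s \<le> \<alpha>" "\<alpha> < s + 2 * pi"
      using pi_gt_zero by (auto simp: field_simps s_def)
    have c: "circ x r (t - s) = circ x r t" for t
      unfolding circ_eq_iff[OF assms(1)] s_def by (intro exI[of _ "-n"]) simp
    have "circ x r \<alpha> \<in> K" "circ x r \<beta> \<in> K" using ab(4) g(4,5) by (metis insert_iff singletonD)+
    then have "\<alpha> - s \<in> T" "\<beta> - s \<in> T" using ab(1,2) s by (auto simp: T_def c)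
    moreover have "A = circ x r ` {\<alpha> - s..\<beta> - s}"
    proof -
      have "{\<alpha> - s..\<beta> - s} = (\<lambda>t. t - s) ` {\<alpha>..\<beta>}"
        by (auto simp: image_iff intro!: bexI[of _ "_ + s"])
      then have "circ x r ` {\<alpha> - s..\<beta> - s} = circ x r ` {\<alpha>..\<beta>}" by (simp only: image_image c)
      then show ?thesis using ab(3) g(3) by simp
    qed
    ultimately show ?thesis by (force simp: image_iff)
  qed
  then have "{A. A \<subseteq> sphere x r \<and> (\<exists>g. arc g \<and> path_image g = A \<and> pathstart g \<in> K \<and> pathfinish g \<in> K)}
      \<subseteq> (\<lambda>(\<alpha>, \<beta>). circ x r ` {\<alpha>..\<beta>}) ` (T \<times> T)" by blast
  moreover have "finite ((\<lambda>(\<alpha>, \<beta>). circ x r ` {\<alpha>..\<beta>}) ` (T \<times> T))"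
    using \<open>finite T\<close> by blast
  ultimately show ?thesis by (rule finite_subset)
qed

end


section \<open>Supporting functionals and minor arcs\<close>

text \<open>
  A hyperplane that separates \<open>u\<close> from the open ball of radius \<open>norm u\<close>, rescaled to a functional of
  norm 1 that attains its norm at \<open>u\<close>.
\<close>
lemma support_functional_normalize:
  fixes f :: "'a::real_normed_vector \<Rightarrow> real"
  assumes "linear f" "u \<noteq> 0" "\<And>z. norm z < norm u \<Longrightarrow> f z \<le> b" "f u \<ge> b" "b > 0"
  shows "linear (\<lambda>z. norm u / f u * f z)" "norm u / f u * f u = norm u"
    "norm u / f u * f z \<le> norm z"
proof -
  show "linear (\<lambda>z. norm u / f u * f z)"
    using assms(1) by (intro linearI) (simp_all add: linear_add linear_scale distrib_left)
  show "norm u / f u * f u = norm u" using assms(4,5) by simp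
  have fu: "f u > 0" using assms(4,5) by linarith
  show "norm u / f u * f z \<le> norm z"
  proof (cases "f z > 0")
    case True
    then have "z \<noteq> 0" using assms(1) by (auto simp: linear_0)
    show ?thesis
    proof (rule ccontr)
      assume "\<not> ?thesis"
      then have "norm u * f z > norm z * f u" using fu by (simp add: field_simps)
      \<comment> \<open>a point on the ray of \<open>z\<close>, still shorter than \<open>u\<close>, on which \<open>f\<close> exceeds \<open>f u\<close>\<close>
      then have "f u / f z < norm u / norm z"
        using True \<open>z \<noteq> 0\<close> by (simp add: field_simps)
      then obtain s where s: "f u / f z < s" "s < norm u / norm z" using dense by blast
      have "0 < f u / f z" using fu True by simp
      with s(1) have "s > 0" by linarith
      have "norm (s *\<^sub>R z) < norm u" using s(2) \<open>z \<noteq> 0\<close> \<open>s > 0\<close> by (simp add: field_simps)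
      then have "f (s *\<^sub>R z) \<le> b" by (rule assms(3))
      moreover have "f (s *\<^sub>R z) > f u"
        using s(1) True assms(1) by (simp add: linear_scale field_simps)
      ultimately show False using assms(4) by simp
    qed
  next
    case False
    then have "norm u / f u * f z \<le> 0" using fu by (intro mult_nonneg_nonpos) auto
    then show ?thesis using norm_ge_zero[of z] by linarith
  qed
qed

text \<open>
  The points \<open>(1 - t) *\<^sub>R p + t *\<^sub>R q\<close> and \<open>t *\<^sub>R p + (1 - t) *\<^sub>R q\<close> add up to \<open>p + q\<close> and have norm at most \<open>r\<close>.
  So equality in the triangle inequality forces norm \<open>r\<close> on the whole segment from \<open>p\<close> to \<open>q\<close>.
\<close>
lemma strictly_convex_sum_imp_eq:
  assumes "strictly_convex_space TYPE('a::real_normed_vector)"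
    and "norm (p :: 'a) \<le> r" "norm q \<le> r" "norm (p + q) = 2 * r" "r > 0"
  shows "p = q"
proof (rule ccontr)
  assume "p \<noteq> q"
  have "norm ((1 - t) *\<^sub>R p + t *\<^sub>R q) = r" if "0 \<le> t" "t \<le> 1" for t
  proof -
    have le: "norm ((1 - t) *\<^sub>R p + t *\<^sub>R q) \<le> r" if "0 \<le> t" "t \<le> 1" for t
    proof -
      have "norm ((1 - t) *\<^sub>R p + t *\<^sub>R q) \<le> (1 - t) * norm p + t * norm q"
        using that by (intro norm_triangle_le) simp
      also have "\<dots> \<le> (1 - t) * r + t * r"
        using that assms(2,3) by (intro add_mono mult_left_mono) auto
      finally show ?thesis by (simp add: algebra_simps)
    qed
    have "p + q = ((1 - t) *\<^sub>R p + t *\<^sub>R q) + ((1 - (1 - t)) *\<^sub>R p + (1 - t) *\<^sub>R q)"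
      by (simp add: algebra_simps)
    then have "2 * r \<le> norm ((1 - t) *\<^sub>R p + t *\<^sub>R q) + norm ((1 - (1 - t)) *\<^sub>R p + (1 - t) *\<^sub>R q)"
      using assms(4) norm_triangle_ineq[of "(1 - t) *\<^sub>R p + t *\<^sub>R q" "(1 - (1 - t)) *\<^sub>R p + (1 - t) *\<^sub>R q"]
      by simp
    then show ?thesis using le[of t] le[of "1 - t"] that by simp
  qed
  then have "norm ((1 - t) *\<^sub>R (p /\<^sub>R r) + t *\<^sub>R (q /\<^sub>R r)) = 1" if "0 \<le> t" "t \<le> 1" for t
  proof -
    have "(1 - t) *\<^sub>R (p /\<^sub>R r) + t *\<^sub>R (q /\<^sub>R r) = ((1 - t) *\<^sub>R p + t *\<^sub>R q) /\<^sub>R r"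
      by (simp add: algebra_simps)
    then show ?thesis using \<open>0 \<le> t \<Longrightarrow> t \<le> 1 \<Longrightarrow> _\<close> that \<open>r > 0\<close> by simp
  qed
  then have "closed_segment (p /\<^sub>R r) (q /\<^sub>R r) \<subseteq> sphere 0 1"
    by (auto simp: closed_segment_def)
  moreover have "p /\<^sub>R r \<noteq> q /\<^sub>R r" using \<open>p \<noteq> q\<close> \<open>r > 0\<close> by simp
  ultimately show False using assms(1) unfolding strictly_convex_space_def by blast
qed

context coordinatized_plane
begin

text \<open>
  The Hahn--Banach theorem for a plane, by separating a point from a convex set in the coordinates.
\<close>
lemma support_functional:
  assumes "u \<noteq> (0 :: 'a)"
  obtains f :: "'a \<Rightarrow> real" where "linear f" "f u = norm u" "\<And>z. f z \<le> norm z"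
proof -
  let ?S = "{z. norm (\<phi> z) < norm u}"
  have im: "?S = inv \<phi> ` ball 0 (norm u)"
    by (auto simp: image_iff \<phi>_inverse intro!: bexI[of _ "\<phi> _"])
  have "convex ?S"
    unfolding im by (intro convex_linear_image linear_inv convex_ball)
  moreover have "?S \<noteq> {}" using assms lin by (auto intro!: exI[of _ 0] simp: linear_0)
  ultimately obtain a b where ab: "a \<noteq> 0" "\<forall>x\<in>?S. inner a x \<le> b" "\<forall>x\<in>{inv \<phi> u}. inner a x \<ge> b"
    using separating_hyperplane_sets[of ?S "{inv \<phi> u}"] by (auto simp: \<phi>_inverse)
  define f where "f z = inner a (inv \<phi> z)" for z
  have "linear f"
    by (rule linearI) (simp_all add: f_def linear_add[OF linear_inv] linear_scale[OF linear_inv] inner_right_distrib)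
  have fb: "f z \<le> b" if "norm z < norm u" for z
    using ab(2) that by (simp add: f_def \<phi>_inverse)
  have "\<phi> a \<noteq> 0" using ab(1) by (simp add: \<phi>_eq_0)
  then have "f ((norm u / 2 / norm (\<phi> a)) *\<^sub>R \<phi> a) \<le> b"
    using assms by (intro fb) simp
  moreover have "f ((norm u / 2 / norm (\<phi> a)) *\<^sub>R \<phi> a) > 0"
    using \<open>\<phi> a \<noteq> 0\<close> assms ab(1) \<open>linear f\<close> by (simp add: linear_scale) (simp add: f_def \<phi>_inverse)
  ultimately have "b > 0" by linarith
  have "f u \<ge> b" using ab(3) by (simp add: f_def)
  note n = support_functional_normalize[OF \<open>linear f\<close> assms fb this \<open>b > 0\<close>]
  show ?thesis by (rule that[OF n])
qed

lemma linear_functional_continuous: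
  assumes "linear (f :: 'a \<Rightarrow> real)"
  shows "continuous_on S f"
proof -
  have "linear (f \<circ> \<phi>)" using assms lin by (simp add: linear_compose)
  then have "continuous_on UNIV (f \<circ> \<phi>)"
    by (intro linear_continuous_on) (simp only: linear_conv_bounded_linear)
  then have "continuous_on S (\<lambda>z. (f \<circ> \<phi>) (inv \<phi> z))"
    by (rule continuous_on_compose2) (auto intro: continuous_inv)
  then show ?thesis by (simp add: \<phi>_inverse)
qed

text \<open>
  Two linearly independent vectors span the plane; the coefficients are those of Cramer's rule.
\<close>
lemma expand_in_basis:
  assumes "\<And>s t. s *\<^sub>R p + t *\<^sub>R q = (0::'a) \<Longrightarrow> s = 0 \<and> t = 0"
  obtains \<alpha> \<beta> where "y = \<alpha> *\<^sub>R p + \<beta> *\<^sub>R q"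
proof -
  define P Q Y where "P = inv \<phi> p" and "Q = inv \<phi> q" and "Y = inv \<phi> y"
  have eq: "s *\<^sub>R p + t *\<^sub>R q = \<phi> (s *\<^sub>R P + t *\<^sub>R Q)" for s t
    using lin by (simp add: linear_add linear_scale P_def Q_def \<phi>_inverse)
  define D where "D = Re P * Im Q - Im P * Re Q"
  have "D \<noteq> 0"
  proof
    assume D: "D = 0"
    have "Re Q *\<^sub>R P + (- Re P) *\<^sub>R Q = 0" "Im Q *\<^sub>R P + (- Im P) *\<^sub>R Q = 0"
      using D by (auto simp: complex_eq_iff D_def algebra_simps)
    then have "Re Q *\<^sub>R p + (- Re P) *\<^sub>R q = 0" "Im Q *\<^sub>R p + (- Im P) *\<^sub>R q = 0"
      by (simp_all only: eq linear_0[OF lin])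
    then have "P = 0" using assms[of "Re Q" "- Re P"] assms[of "Im Q" "- Im P"] by (simp add: complex_eq_iff)
    then have "1 *\<^sub>R p + 0 *\<^sub>R q = 0" by (simp only: eq) (simp add: linear_0[OF lin])
    then show False using assms by fastforce
  qed
  define \<alpha> where "\<alpha> = (Re Y * Im Q - Im Y * Re Q) / D"
  define \<beta> where "\<beta> = (Re P * Im Y - Im P * Re Y) / D"
  have "Re Y * D = (Re Y * Im Q - Im Y * Re Q) * Re P + (Re P * Im Y - Im P * Re Y) * Re Q"
    "Im Y * D = (Re Y * Im Q - Im Y * Re Q) * Im P + (Re P * Im Y - Im P * Re Y) * Im Q"
    by (simp_all add: D_def algebra_simps)
  then have "Y = \<alpha> *\<^sub>R P + \<beta> *\<^sub>R Q"
    using \<open>D \<noteq> 0\<close>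
    by (simp add: complex_eq_iff \<alpha>_def \<beta>_def add_divide_distrib[symmetric] eq_divide_eq)
  then have "\<phi> Y = \<alpha> *\<^sub>R p + \<beta> *\<^sub>R q" by (simp only: eq)
  then have "y = \<alpha> *\<^sub>R p + \<beta> *\<^sub>R q" by (simp add: Y_def \<phi>_inverse)
  then show ?thesis by (rule that)
qed

text \<open>
  Two vectors of equal norm are dependent only if they are equal or opposite, and opposite vectors are
  at distance \<open>2 * r\<close>.
\<close>
lemma close_points_independent:
  assumes "norm p = r" "norm q = r" "r > 0" "p \<noteq> q" "norm (p - q) < 2 * r"
    "s *\<^sub>R p + t *\<^sub>R q = (0::'a)"
  shows "s = 0 \<and> t = 0"
proof -
  have "s *\<^sub>R p = (- t) *\<^sub>R q" using assms(6) by (simp add: eq_neg_iff_add_eq_0)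
  then have "norm (s *\<^sub>R p) = norm ((- t) *\<^sub>R q)" by simp
  then have "\<bar>s\<bar> = \<bar>t\<bar>" using assms(1-3) by simp
  then consider "s = t" | "s = - t" by linarith
  then show ?thesis
  proof cases
    case 1
    show ?thesis
    proof (rule ccontr)
      assume "\<not> ?thesis"
      then have "s \<noteq> 0" using 1 by simp
      have "s *\<^sub>R (p + q) = 0" using assms(6) 1 by (simp add: algebra_simps)
      then have "q = - p" using \<open>s \<noteq> 0\<close> by (simp add: add_eq_0_iff)
      then have "p - q = 2 *\<^sub>R p" by (simp add: scaleR_2)
      then show False using assms(1,5) by simp
    qed
  next
    case 2
    then have "t *\<^sub>R (q - p) = 0" using assms(6) by (simp add: algebra_simps)
    then show ?thesis using assms(4) 2 by simp
  qed
qed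

text \<open>
  The arithmetic of \<open>minor_arc_in_disc_centered\<close>, stated for one coordinate because it is used for
  both. There \<open>fp\<close> and \<open>fq\<close> are the values of \<open>f\<close> at \<open>p\<close> and \<open>q\<close>, and \<open>hp\<close> is the value at \<open>p\<close> of a functional
  attaining its norm at \<open>q\<close>. Then \<open>r *\<^sub>R f - fq *\<^sub>R h\<close> vanishes at \<open>q\<close>, is positive at \<open>p\<close>, and is negative at
  the point with coordinates \<open>\<alpha>\<close> and \<open>\<beta>\<close>.
\<close>
lemma coefficient_negative:
  fixes fp fq :: real
  assumes "fq > 0" "r > 0" "s > 0" "s * fp + t * fq > fq" "s * hp + t * r \<le> r"
    "\<alpha> * hp + \<beta> * r \<ge> 0" "\<alpha> * fp + \<beta> * fq < 0"
  shows "\<alpha> < 0 \<and> r * fp > hp * fq"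
proof -
  have "(s * hp + t * r) * fq \<le> r * fq" using assms(1,5) by (simp add: mult_right_mono)
  also have "\<dots> < r * (s * fp + t * fq)" using assms(2,4) by simp
  finally have "s * (hp * fq) < s * (r * fp)" by (simp add: algebra_simps)
  then have *: "hp * fq < r * fp" using assms(3) by simp
  have "r * (\<alpha> * fp + \<beta> * fq) < 0" using assms(2,7) by (simp add: mult_pos_neg)
  moreover have "(\<alpha> * hp + \<beta> * r) * fq \<ge> 0" using assms(1,6) by simp
  ultimately have "\<alpha> * (r * fp - hp * fq) < 0" by (simp add: algebra_simps)
  then show ?thesis using * by (simp add: mult_less_0_iff)
qed

text \<open>
  Let \<open>f\<close>, \<open>g\<close>, \<open>h\<close> attain their norm at \<open>z - y\<close>, \<open>p\<close>, \<open>q\<close>. If \<open>z\<close> were outside the disc around \<open>y\<close>, then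
  \<open>f\<close> would be larger at \<open>z\<close> than at \<open>p\<close> and \<open>q\<close> and negative at \<open>y\<close>, while \<open>g\<close> and \<open>h\<close> are nonnegative at \<open>y\<close>
  because \<open>p\<close> and \<open>q\<close> lie in that disc. These inequalities force both coordinates of \<open>y\<close> with
  respect to \<open>p\<close> and \<open>q\<close> to be negative, and then \<open>g\<close> and \<open>h\<close> cannot both be nonnegative at \<open>y\<close>, as
  \<open>norm (p - q) < 2 * r\<close> gives \<open>g q > - r\<close> and \<open>h p > - r\<close>. The bound on \<open>norm (p - q)\<close> is essential: for the
  maximum norm, opposite sides of a square carry points at distance \<open>2 * r\<close> for which the claim fails.
\<close>
lemma minor_arc_in_disc_centered:
  fixes p q y :: 'a
  assumes "norm p = r" "norm q = r" "r > 0" "p \<noteq> q" "norm (p - q) < 2 * r"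
    "norm (p - y) \<le> r" "norm (q - y) \<le> r"
    "z = s *\<^sub>R p + t *\<^sub>R q" "s \<ge> 0" "t \<ge> 0" "norm z = r"
  shows "norm (z - y) \<le> r"
proof (rule ccontr)
  assume far: "\<not> norm (z - y) \<le> r"
  obtain \<alpha> \<beta> where y: "y = \<alpha> *\<^sub>R p + \<beta> *\<^sub>R q"
    using expand_in_basis[OF close_points_independent[OF assms(1-5)]] by blast
  have nz: "z - y \<noteq> 0" "p \<noteq> 0" "q \<noteq> 0" using far assms(1-3) by auto
  obtain f :: "'a \<Rightarrow> real" where f: "linear f" "f (z - y) = norm (z - y)" "\<And>v. f v \<le> norm v"
    using support_functional[OF nz(1)] by blast
  obtain g :: "'a \<Rightarrow> real" where g: "linear g" "g p = norm p" "\<And>v. g v \<le> norm v"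
    using support_functional[OF nz(2)] by blast
  obtain h :: "'a \<Rightarrow> real" where h: "linear h" "h q = norm q" "\<And>v. h v \<le> norm v"
    using support_functional[OF nz(3)] by blast
  note lins = linear_add[OF f(1)] linear_scale[OF f(1)] linear_diff[OF f(1)]
    linear_add[OF g(1)] linear_scale[OF g(1)] linear_diff[OF g(1)]
    linear_add[OF h(1)] linear_scale[OF h(1)] linear_diff[OF h(1)]
  have "r \<le> (s + t) * r"
    using norm_triangle_ineq[of "s *\<^sub>R p" "t *\<^sub>R q"] assms by (simp add: algebra_simps)
  then have st: "s + t \<ge> 1" using assms(3) by simp
  have fz: "f z = s * f p + t * f q" using assms(8) by (simp add: lins)
  have fzp: "f z > f p" "f z > f q"
    using f(3)[of "p - y"] f(3)[of "q - y"] f(2) far assms(6,7) by (simp_all add: lins)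
  have fy: "f y < 0" using f(2) f(3)[of z] far assms(11) by (simp add: lins)
  have gy: "g y \<ge> 0" using g(3)[of "p - y"] g(2) assms(1,6) by (simp add: lins)
  have hy: "h y \<ge> 0" using h(3)[of "q - y"] h(2) assms(2,7) by (simp add: lins)
  have gz: "s * r + t * g q \<le> r" using g(3)[of z] g(2) assms(1,8,11) by (simp add: lins)
  have hz: "s * h p + t * r \<le> r" using h(3)[of z] h(2) assms(2,8,11) by (simp add: lins)
  have gq: "g q > - r" using g(3)[of "p - q"] g(2) assms(1,5) by (simp add: lins)
  have hp: "h p > - r" using h(3)[of "q - p"] h(2) assms(2,5) by (simp add: lins norm_minus_commute)
  have y1: "\<alpha> * r + \<beta> * g q \<ge> 0" using gy y g(2) assms(1) by (simp add: lins)
  have y2: "\<alpha> * h p + \<beta> * r \<ge> 0" using hy y h(2) assms(2) by (simp add: lins)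
  have y3: "\<alpha> * f p + \<beta> * f q < 0" using fy y by (simp add: lins)
  have "s > 0"
  proof (rule ccontr)
    assume "\<not> s > 0"
    then have "z = t *\<^sub>R q" using assms(8,9) by simp
    then have "z = q" using assms(2,3,10,11) by simp
    then show False using fzp by simp
  qed
  have "t > 0"
  proof (rule ccontr)
    assume "\<not> t > 0"
    then have "z = s *\<^sub>R p" using assms(8,10) by simp
    then have "z = p" using assms(1,3,9,11) by simp
    then show False using fzp by simp
  qed
  have pos: "f p > 0 \<or> f q > 0"
  proof (rule ccontr)
    assume "\<not> ?thesis"
    then have n: "f p \<le> 0" "f q \<le> 0" by auto
    define m where "m = max (f p) (f q)"
    have "s * f p + t * f q \<le> s * m + t * m"
      using assms(9,10) by (intro add_mono mult_left_mono) (auto simp: m_def)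
    also have "\<dots> = (s + t) * m" by (simp add: algebra_simps)
    also have "\<dots> \<le> 1 * m" using st n by (intro mult_right_mono_neg) (auto simp: m_def)
    finally show False using fz fzp by (simp add: m_def)
  qed
  have \<alpha>: "\<alpha> < 0 \<and> r * f p > h p * f q" if "f q > 0"
    using coefficient_negative[OF that assms(3) \<open>s > 0\<close> _ hz y2 y3] fz fzp by simp
  have \<beta>: "\<beta> < 0 \<and> r * f q > g q * f p" if "f p > 0"
    using coefficient_negative[of "f p" r t "f q" s "g q" \<beta> \<alpha>] that assms(3) \<open>t > 0\<close> gz y1 y3 fz fzp
    by (simp add: algebra_simps)
  have neg: "\<alpha> < 0 \<and> \<beta> < 0"
  proof (cases "f p > 0 \<and> f q > 0")
    case False
    then consider "f q > 0" "f p \<le> 0" | "f p > 0" "f q \<le> 0" using pos by linarith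
    then show ?thesis
    proof cases
      case 1
      then have "\<alpha> < 0" using \<alpha> by blast
      then have "\<alpha> * f p \<ge> 0" using 1(2) by (simp add: mult_nonpos_nonpos)
      then have "\<beta> * f q < 0" using y3 by linarith
      then have "\<beta> < 0" using 1(1) by (simp add: mult_less_0_iff)
      then show ?thesis using \<open>\<alpha> < 0\<close> by simp
    next
      case 2
      then have "\<beta> < 0" using \<beta> by blast
      then have "\<beta> * f q \<ge> 0" using 2(2) by (simp add: mult_nonpos_nonpos)
      then have "\<alpha> * f p < 0" using y3 by linarith
      then have "\<alpha> < 0" using 2(1) by (simp add: mult_less_0_iff)
      then show ?thesis using \<open>\<beta> < 0\<close> by simp
    qed
  qed (use \<alpha> \<beta> in blast)
  have "\<beta> * g q < \<beta> * (- r)" "\<alpha> * h p < \<alpha> * (- r)"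
    using neg gq hp by (simp_all only: mult_less_cancel_left_neg)
  then have "\<alpha> * r > \<beta> * r" "\<beta> * r > \<alpha> * r" using y1 y2 by simp_all
  then show False by simp
qed

end


section \<open>Ball hulls, ball intersections and their boundary arcs\<close>

lemma ball_inter_iff: "x \<in> ball_inter K r \<longleftrightarrow> K \<subseteq> cball x r"
  by (auto simp: ball_inter_def dist_commute)

lemma ball_hull_subset_cball: "K \<subseteq> cball x r \<Longrightarrow> ball_hull K r \<subseteq> cball x r"
  by (auto simp: ball_hull_def)

lemma subset_ball_hull: "K \<subseteq> ball_hull K r"
  by (auto simp: ball_hull_def)

lemma ball_inter_subset_cball: "c \<in> K \<Longrightarrow> ball_inter K r \<subseteq> cball c r"
  by (auto simp: ball_inter_def)

lemma closed_ball_hull: "closed (ball_hull K r)"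
  by (auto simp: ball_hull_def)

lemma closed_ball_inter: "closed (ball_inter K r)"
  by (auto simp: ball_inter_def)

text \<open>
  Moving away from the center, along the ray through \<open>y\<close>, leaves the disc and hence \<open>S\<close> at once.
  Applied to the ball hull and to the ball intersection, this provides all the boundary points needed.
\<close>
lemma sphere_point_in_frontier:
  fixes x :: "'a::real_normed_vector"
  assumes "S \<subseteq> cball x r" "y \<in> S" "y \<in> sphere x r" "r > 0"
  shows "y \<in> frontier S"
proof -
  have "y \<notin> interior S"
  proof
    assume "y \<in> interior S"
    then obtain e where e: "e > 0" "ball y e \<subseteq> S" by (meson mem_interior)
    define z where "z = y + (e / (2 * r)) *\<^sub>R (y - x)"
    have nyx: "norm (y - x) = r" using assms(3) by (simp add: dist_norm norm_minus_commute)
    have "dist y z < e" using e(1) assms(4) nyx by (simp add: z_def dist_norm)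
    then have "z \<in> cball x r" using e(2) assms(1) by (auto simp del: mem_cball)
    moreover have "z - x = (1 + e / (2 * r)) *\<^sub>R (y - x)" by (simp add: z_def algebra_simps)
    then have "norm (z - x) = (1 + e / (2 * r)) * r" using e(1) assms(4) nyx by simp
    then have "norm (z - x) = r + e / 2" using assms(4) by (simp add: distrib_right)
    then have "norm (z - x) > r" using e(1) by simp
    ultimately show False by (simp add: dist_norm norm_minus_commute)
  qed
  then show ?thesis using assms(2) closure_subset by (auto simp: frontier_def)
qed

text \<open>
  The segment from \<open>x + a\<close> to \<open>x + b\<close>, projected from \<open>x\<close> to \<open>sphere x r\<close>.
\<close>
definition radial_path :: "'a::real_normed_vector \<Rightarrow> real \<Rightarrow> 'a \<Rightarrow> 'a \<Rightarrow> real \<Rightarrow> 'a" where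
  "radial_path x r a b t = x + r *\<^sub>R sgn ((1 - t) *\<^sub>R a + t *\<^sub>R b)"

lemma radial_path_on_sphere:
  assumes "r > 0" "\<And>t. t \<in> {0..1} \<Longrightarrow> (1 - t) *\<^sub>R a + t *\<^sub>R b \<noteq> 0"
  shows "path (radial_path x r a b)" "path_image (radial_path x r a b) \<subseteq> sphere x r"
proof -
  show "path (radial_path x r a b)"
    unfolding path_def radial_path_def sgn_div_norm using assms(2)
    by (intro continuous_intros) auto
  show "path_image (radial_path x r a b) \<subseteq> sphere x r"
    using assms by (auto simp: path_image_def radial_path_def dist_norm norm_sgn)
qed

lemma radial_path_ends:
  assumes "norm a = r" "norm b = r" "r > 0"
  shows "radial_path x r a b 0 = x + a" "radial_path x r a b 1 = x + b"
  using assms by (auto simp: radial_path_def sgn_div_norm)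

text \<open>
  The radial path from \<open>a\<close> towards a point \<open>u\<close> at which \<open>f\<close> exceeds \<open>\<bar>f a\<bar>\<close> immediately increases \<open>f\<close>. Where
  \<open>f\<close> is nonnegative on the segment, the projection to the circle only helps; where it is negative,
  the projection decreases \<open>f\<close>, but by less than the gain, because \<open>norm w \<ge> (1 - 2 * t) * r\<close>.
\<close>
lemma radial_functional_increase:
  fixes f :: "'a::real_normed_vector \<Rightarrow> real"
  assumes "linear f" "norm a = r" "norm u = r" "r > 0" "f u > \<bar>f a\<bar>" "0 < t" "t \<le> 1"
    and w: "w = (1 - t) *\<^sub>R a + t *\<^sub>R u"
  shows "w \<noteq> 0" "r * f (sgn w) > f a"
proof -
  have fw: "f w = (1 - t) * f a + t * f u" using assms(1) by (simp add: w linear_add linear_scale)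
  show nz: "w \<noteq> 0"
  proof
    assume "w = 0"
    then have e: "(1 - t) *\<^sub>R a = - (t *\<^sub>R u)" by (simp add: w eq_neg_iff_add_eq_0)
    then have "norm ((1 - t) *\<^sub>R a) = norm (t *\<^sub>R u)" by simp
    then have "1 - t = t" using assms by simp
    then have "t * (f a + f u) = f w" by (simp only: fw distrib_left)
    then have "f a + f u = 0" using \<open>w = 0\<close> linear_0[OF assms(1)] assms(6) by simp
    then show False using assms(5) by simp
  qed
  have "r * f w > f a * norm w"
  proof (cases "f a \<ge> 0")
    case True
    have "norm w \<le> (1 - t) * r + t * r"
      unfolding w by (rule norm_triangle_le) (use assms in simp)
    then have "norm w \<le> r" by (simp add: algebra_simps)
    then have "f a * norm w \<le> f a * r" using True by (rule mult_left_mono)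
    also have "t * (f u - f a) > 0" using assms(5,6) by simp
    then have "f w > f a" using fw by (simp add: algebra_simps)
    then have "f a * r < r * f w" using assms(4) by (simp add: mult.commute)
    finally show ?thesis .
  next
    case False
    have "norm w \<ge> norm ((1 - t) *\<^sub>R a) - norm (t *\<^sub>R u)"
      unfolding w by (rule norm_diff_ineq)
    moreover have "norm ((1 - t) *\<^sub>R a) = (1 - t) * r" "norm (t *\<^sub>R u) = t * r"
      using assms(2,3,6,7) by simp_all
    ultimately have "norm w \<ge> (1 - 2 * t) * r" by (simp add: algebra_simps)
    then have "f a * norm w \<le> f a * ((1 - 2 * t) * r)" using False by (intro mult_left_mono_neg) auto
    moreover have "r * f w - f a * ((1 - 2 * t) * r) = r * (t * (f u + f a))"
      by (simp add: fw algebra_simps)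
    moreover have "r * (t * (f u + f a)) > 0" using assms(4-6) by simp
    ultimately show ?thesis by linarith
  qed
  then show "r * f (sgn w) > f a"
    using nz assms(1) by (simp add: sgn_div_norm linear_scale field_simps)
qed

context coordinatized_plane
begin

text \<open>
  If \<open>f u > \<bar>f (c - x)\<bar>\<close>, then \<open>f\<close> exceeds \<open>f c\<close> on the whole radial path from \<open>c\<close> to \<open>x + u\<close>,
  except at its start. As \<open>f\<close> is at most \<open>f c\<close> on the arc, this path leaves the arc
  immediately without meeting an end, which is impossible. The absolute value cannot be dropped:
  \<open>c\<close> may be an inner point of a segment of the circle on which \<open>f\<close> is minimal.
\<close>
lemma functional_extremal_inside_arc:
  fixes x :: 'a and f :: "'a \<Rightarrow> real"
  assumes "arc g" "path_image g \<subseteq> sphere x r" "r > 0"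
    and "c \<in> path_image g" "c \<notin> {pathstart g, pathfinish g}"
    and "linear f" "\<And>y. y \<in> path_image g \<Longrightarrow> f y \<le> f c"
    and "norm u = r"
  shows "f u \<le> \<bar>f (c - x)\<bar>"
proof (rule ccontr)
  assume gt: "\<not> ?thesis"
  define a where "a = c - x"
  have a: "norm a = r" using assms(2,4) by (auto simp: a_def dist_norm norm_minus_commute)
  note inc = radial_functional_increase[where f = f, OF assms(6) a assms(8,3)]
  have gt': "f u > \<bar>f a\<bar>" using gt by (simp add: a_def)
  let ?h = "radial_path x r a u"
  have nz: "(1 - t) *\<^sub>R a + t *\<^sub>R u \<noteq> 0" if "t \<in> {0..1}" for t
    using inc(1)[OF gt', of t] that a assms(3) by (cases "t = 0") auto
  have up: "f (?h t) > f c" if "0 < t" "t \<le> 1" for t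
    using inc(2)[OF gt' that refl] by (simp add: radial_path_def linear_add[OF assms(6)]
        linear_scale[OF assms(6)] linear_diff[OF assms(6)] a_def)
  have h0: "?h 0 = c" using radial_path_ends(1)[OF a assms(8,3)] by (simp add: a_def)
  have "?h 1 \<notin> path_image g" using up[of 1] assms(7) by fastforce
  then obtain t where t: "t \<in> {0..1}" "?h t \<in> {pathstart g, pathfinish g}"
    using path_meets_end_of_arc[OF assms(1-3) radial_path_on_sphere[OF assms(3) nz]] h0 assms(4) by metis
  then have "t \<noteq> 0" using h0 assms(5) by auto
  then have "f (?h t) > f c" using t(1) by (intro up) auto
  moreover have "?h t \<in> path_image g"
    using t(2) pathstart_in_path_image pathfinish_in_path_image by (metis insertE singletonD)
  ultimately show False using assms(7) by fastforce
qed

lemma arc_radial_path: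
  fixes a b :: 'a
  assumes "norm a = r" "norm b = r" "r > 0" "a \<noteq> b" "norm (a - b) < 2 * r"
  shows "arc (radial_path x r a b)"
  unfolding arc_def
proof
  note ind = close_points_independent[OF assms]
  have nz: "(1 - t) *\<^sub>R a + t *\<^sub>R b \<noteq> 0" for t
    using ind[of "1 - t" t] by auto
  then show "path (radial_path x r a b)" using radial_path_on_sphere(1)[OF assms(3)] by blast
  show "inj_on (radial_path x r a b) {0..1}"
  proof (rule inj_onI)
    fix s t :: real
    assume "radial_path x r a b s = radial_path x r a b t"
    then have eq: "sgn ((1 - s) *\<^sub>R a + s *\<^sub>R b) = sgn ((1 - t) *\<^sub>R a + t *\<^sub>R b)"
      using assms(3) by (simp add: radial_path_def)
    define m n where "m = norm ((1 - s) *\<^sub>R a + s *\<^sub>R b)" and "n = norm ((1 - t) *\<^sub>R a + t *\<^sub>R b)"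
    have mn: "m \<noteq> 0" "n \<noteq> 0" using nz by (simp_all add: m_def n_def)
    have "((1 - s) / m - (1 - t) / n) *\<^sub>R a + (s / m - t / n) *\<^sub>R b =
      ((1 - s) *\<^sub>R a + s *\<^sub>R b) /\<^sub>R m - ((1 - t) *\<^sub>R a + t *\<^sub>R b) /\<^sub>R n"
      by (simp add: algebra_simps divide_inverse)
    also have "\<dots> = 0" using eq by (simp add: sgn_div_norm m_def n_def)
    finally have "(1 - s) / m - (1 - t) / n = 0 \<and> s / m - t / n = 0" by (rule ind)
    then have st: "(1 - s) / m = (1 - t) / n" "s / m = t / n" by simp_all
    then have "1 / m = 1 / n" by (simp add: diff_divide_distrib)
    then show "s = t" using st(2) mn by simp
  qed
qed

lemma minor_arc_in_disc:
  fixes x y c c' :: 'a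
  assumes "c \<in> sphere x r" "c' \<in> sphere x r" "r > 0" "c \<noteq> c'" "dist c c' < 2 * r"
    "c \<in> cball y r" "c' \<in> cball y r"
  shows "path_image (radial_path x r (c - x) (c' - x)) \<subseteq> cball y r"
proof clarify
  fix z assume "z \<in> path_image (radial_path x r (c - x) (c' - x))"
  then obtain t where t: "0 \<le> t" "t \<le> 1" "z = radial_path x r (c - x) (c' - x) t"
    by (auto simp: path_image_def)
  define p q w where "p = c - x" and "q = c' - x" and "w = (1 - t) *\<^sub>R p + t *\<^sub>R q"
  have pq: "norm p = r" "norm q = r" "p \<noteq> q" "norm (p - q) < 2 * r"
    using assms by (auto simp: p_def q_def dist_norm norm_minus_commute)
  have "w \<noteq> 0"
    using close_points_independent[OF pq(1,2) assms(3) pq(3,4), of "1 - t" t] by (auto simp: w_def)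
  have "norm (z - x - (y - x)) \<le> r"
  proof (rule minor_arc_in_disc_centered[OF pq(1,2) assms(3) pq(3,4)])
    show "norm (p - (y - x)) \<le> r" "norm (q - (y - x)) \<le> r"
      using assms(6,7) by (auto simp: p_def q_def dist_norm norm_minus_commute)
    show "z - x = (r * (1 - t) / norm w) *\<^sub>R p + (r * t / norm w) *\<^sub>R q"
      using t(3) by (simp add: radial_path_def sgn_div_norm flip: p_def q_def w_def)
        (simp add: w_def algebra_simps divide_inverse)
    show "norm (z - x) = r"
      using t(3) \<open>w \<noteq> 0\<close> assms(3) by (simp add: radial_path_def norm_sgn flip: p_def q_def w_def)
  qed (use t assms(3) in auto)
  then show "z \<in> cball y r" by (simp add: dist_norm norm_minus_commute)
qed

text \<open>
  If the two points are not antipodal, the minor arc works. Antipodal points occur only when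
  the diameter exceeds \<open>r\<close>, that is, in the strictly convex case; then their midpoint is the only
  admissible center, so the ball hull is a full disc.
\<close>
lemma subarc_joining_points:
  fixes x :: 'a
  assumes "finite K" "r > 0" "strictly_convex_space TYPE('a) \<or> r \<ge> diameter K"
    and "K \<subseteq> cball x r" "c \<in> K" "c' \<in> K" "c \<noteq> c'" "c \<in> sphere x r" "c' \<in> sphere x r"
  obtains B where "B \<in> bh_subarcs K r x" "c \<in> B" "c' \<in> B"
proof (cases "dist c c' < 2 * r")
  case True
  let ?g = "radial_path x r (c - x) (c' - x)"
  have n: "norm (c - x) = r" "norm (c' - x) = r" "c - x \<noteq> c' - x" "norm (c - x - (c' - x)) < 2 * r"
    using assms True by (auto simp: dist_norm norm_minus_commute)
  have arc: "arc ?g" using arc_radial_path[OF n(1,2) assms(2) n(3,4)] .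
  have ends: "pathstart ?g = c" "pathfinish ?g = c'"
    using radial_path_ends[OF n(1,2) assms(2)] by (auto simp: pathstart_def pathfinish_def)
  have "(1 - t) *\<^sub>R (c - x) + t *\<^sub>R (c' - x) \<noteq> 0" for t
    using close_points_independent[OF n(1,2) assms(2) n(3,4), of "1 - t" t] by auto
  then have sph: "path_image ?g \<subseteq> sphere x r" using radial_path_on_sphere(2)[OF assms(2)] by blast
  have "path_image ?g \<subseteq> cball y r" if "K \<subseteq> cball y r" for y
    using that assms(5,6) by (intro minor_arc_in_disc[OF assms(8,9,2,7) True]) auto
  then have hull: "path_image ?g \<subseteq> ball_hull K r" unfolding ball_hull_def by blast
  have "path_image ?g \<subseteq> frontier (ball_hull K r)"
  proof
    fix z assume "z \<in> path_image ?g"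
    then show "z \<in> frontier (ball_hull K r)"
      using hull sph by (intro sphere_point_in_frontier[OF ball_hull_subset_cball[OF assms(4)] _ _ assms(2)]) auto
  qed
  then have "path_image ?g \<in> bh_subarcs K r x"
    unfolding bh_subarcs_def mem_Collect_eq
    by (intro conjI assms(4) disjI1 exI[of _ ?g] arc refl) (use sph ends assms(5,6) in auto)
  then show ?thesis
    using that[of "path_image ?g"] ends pathstart_in_path_image[of ?g] pathfinish_in_path_image[of ?g] by simp
next
  case False
  have "dist c c' \<le> diameter K"
    using assms(1,5,6) by (simp add: diameter_bounded_bound finite_imp_bounded)
  then have sc: "strictly_convex_space TYPE('a)" using assms(2,3) False by auto
  have "dist c c' \<le> 2 * r" using dist_triangle[of c c' x] assms(8,9) by (simp add: dist_commute)
  then have d: "norm (c - c') = 2 * r" using False by (simp add: dist_norm)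
  have mid: "y = (1/2) *\<^sub>R (c + c')" if "K \<subseteq> cball y r" for y
  proof -
    have "c - y = y - c'"
    proof (rule strictly_convex_sum_imp_eq[OF sc _ _ _ assms(2)])
      show "norm (c - y) \<le> r" "norm (y - c') \<le> r"
        using that assms(5,6) by (auto simp: dist_norm norm_minus_commute)
      show "norm (c - y + (y - c')) = 2 * r" using d by simp
    qed
    then have "c + c' = 2 *\<^sub>R y" by (simp add: algebra_simps scaleR_2)
    then show ?thesis by simp
  qed
  have "y = x" if "K \<subseteq> cball y r" for y using mid[OF that] mid[OF assms(4)] by simp
  then have hull: "cball x r \<subseteq> ball_hull K r" by (auto simp: ball_hull_def)
  obtain a where a: "0 \<le> a" "a < 0 + 2 * pi" "c = circ x r a"
    by (rule circ_angle[OF assms(8,2)])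
  obtain b where b: "0 \<le> b" "b < 0 + 2 * pi" "c' = circ x r b"
    by (rule circ_angle[OF assms(9,2)])
  let ?g = "circ x r \<circ> linepath a b"
  have arc: "arc ?g" using a b assms(7) by (intro arc_circ[OF assms(2)]) auto
  have ends: "pathstart ?g = c" "pathfinish ?g = c'" using a b by (auto simp: pathstart_compose pathfinish_compose)
  have sph: "path_image ?g \<subseteq> sphere x r" using circ_in_sphere[OF assms(2)] by (auto simp: path_image_def)
  have "path_image ?g \<subseteq> frontier (ball_hull K r)"
  proof
    fix z assume "z \<in> path_image ?g"
    then have z: "z \<in> sphere x r" using sph by blast
    then have "z \<in> ball_hull K r" using hull sphere_cball by blast
    then show "z \<in> frontier (ball_hull K r)"
      by (rule sphere_point_in_frontier[OF ball_hull_subset_cball[OF assms(4)] _ z assms(2)])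
  qed
  then have "path_image ?g \<in> bh_subarcs K r x"
    unfolding bh_subarcs_def mem_Collect_eq
    by (intro conjI assms(4) disjI1 exI[of _ ?g] arc refl) (use sph ends assms(5,6) in auto)
  then show ?thesis
    using that[of "path_image ?g"] ends pathstart_in_path_image[of ?g] pathfinish_in_path_image[of ?g] by simp
qed

lemma finite_bh_subarcs:
  fixes x :: 'a
  assumes "finite K" "r > 0"
  shows "finite (bh_subarcs K r x)"
proof (rule finite_subset)
  show "bh_subarcs K r x \<subseteq> {A. A \<subseteq> sphere x r \<and>
      (\<exists>g. arc g \<and> path_image g = A \<and> pathstart g \<in> K \<and> pathfinish g \<in> K)} \<union> (\<lambda>p. {p}) ` K"
    by (auto simp: bh_subarcs_def)
  show "finite ({A. A \<subseteq> sphere x r \<and>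
      (\<exists>g. arc g \<and> path_image g = A \<and> pathstart g \<in> K \<and> pathfinish g \<in> K)} \<union> (\<lambda>p. {p}) ` K)"
    using finite_arcs_in_sphere[OF assms(2,1)] assms(1) by simp
qed

text \<open>
  The two distinct points ensure that the maximal arc is a proper arc; so its ends are available
  through a parametrization.
\<close>
lemma maximal_arc_joining_points:
  fixes x :: 'a
  assumes "finite K" "r > 0" "strictly_convex_space TYPE('a) \<or> r \<ge> diameter K"
    and "K \<subseteq> cball x r" "c \<in> K" "c' \<in> K" "c \<noteq> c'" "c \<in> sphere x r" "c' \<in> sphere x r"
  obtains g where "path_image g \<in> bh_arcs K r x" "arc g" "path_image g \<subseteq> sphere x r"
    "path_image g \<subseteq> ball_hull K r" "pathstart g \<in> K" "pathfinish g \<in> K" "c \<in> path_image g"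
    "{pathstart g, pathfinish g} \<subseteq> bh_vertices K r"
proof -
  obtain B0 where B0: "B0 \<in> bh_subarcs K r x" "c \<in> B0" "c' \<in> B0"
    using subarc_joining_points[OF assms] by blast
  obtain B where B: "B \<in> bh_subarcs K r x" "B0 \<subseteq> B" "\<forall>A\<in>bh_subarcs K r x. B \<subseteq> A \<longrightarrow> B = A"
    using finite_has_maximal2[OF finite_bh_subarcs[OF assms(1,2)] B0(1)] by blast
  then have max: "B \<in> bh_arcs K r x" by (auto simp: bh_arcs_def)
  have cc: "c \<in> B" "c' \<in> B" using B0 B by auto
  then obtain g where g: "arc g" "path_image g = B" "pathstart g \<in> K" "pathfinish g \<in> K"
    using B(1) assms(7) by (auto simp: bh_subarcs_def)
  have "{pathstart g, pathfinish g} \<subseteq> endpoints B"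
    using g(1,2) by (auto simp: endpoints_def)
  then have "{pathstart g, pathfinish g} \<subseteq> bh_vertices K r"
    using max unfolding bh_vertices_def by blast
  moreover have "B \<subseteq> sphere x r" "B \<subseteq> ball_hull K r"
    using B(1) frontier_subset_closed[OF closed_ball_hull, of K r] by (auto simp: bh_subarcs_def)
  ultimately show ?thesis using that g max cc by metis
qed

text \<open>
  If \<open>c\<close> were the only point of \<open>K\<close> at distance \<open>r\<close> from \<open>x\<close>, all points of \<open>sphere c r\<close> near \<open>x\<close> would belong to
  the ball intersection. Then the component \<open>A\<close> would contain points on both sides of \<open>x\<close>, whereas in a
  parametrization of the arc \<open>A\<close> the end \<open>x\<close> has an extreme parameter.
\<close>
lemma bi_arc_end_on_two_circles:
  fixes x c :: 'a
  assumes "finite K" "r > 0" "A \<in> bi_arcs K r c" "x \<in> endpoints A"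
  shows "\<exists>c'\<in>K. c' \<noteq> c \<and> c' \<in> sphere x r"
proof (rule ccontr)
  assume none: "\<not> ?thesis"
  have cK: "c \<in> K" and comp: "A \<in> components (sphere c r \<inter> frontier (ball_inter K r))"
    using assms(3) by (auto simp: bi_arcs_def split: if_splits)
  have "x \<in> A" using assms(4) by (auto simp: endpoints_def)
  then have x: "x \<in> sphere c r" "x \<in> ball_inter K r"
    using in_components_subset[OF comp] frontier_subset_closed[OF closed_ball_inter[of K r]] by blast+
  obtain \<theta> where \<theta>: "x = circ c r \<theta>" using circ_angle[OF x(1) assms(2)] by blast
  have lt: "dist (circ c r \<theta>) c' < r" if "c' \<in> K - {c}" for c'
  proof -
    have "dist x c' \<le> r" using x(2) that by (auto simp: ball_inter_def dist_commute)
    moreover have "dist x c' \<noteq> r" using none that by auto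
    ultimately show ?thesis using \<theta> by simp
  qed
  have "((\<lambda>s. dist (circ c r s) c') \<longlongrightarrow> dist (circ c r \<theta>) c') (nhds \<theta>)" for c'
    using continuous_circ[of UNIV c r]
    by (intro tendsto_intros) (simp add: continuous_on_eq_continuous_within continuous_within tendsto_nhds_iff)
  \<comment> \<open>finiteness of \<open>K\<close> is used here to obtain one neighbourhood for all circles\<close>
  then have "\<forall>\<^sub>F s in nhds \<theta>. \<forall>c'\<in>K - {c}. dist (circ c r s) c' < r"
    using assms(1) lt by (intro eventually_ball_finite ballI order_tendstoD(2)) auto
  then obtain d where d: "d > 0" "\<And>s. dist s \<theta> < d \<Longrightarrow> \<forall>c'\<in>K - {c}. dist (circ c r s) c' < r"
    by (auto simp: eventually_nhds_metric)
  define \<eta> where "\<eta> = min d pi / 2"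
  have \<eta>: "\<eta> > 0" "\<eta> < d" "2 * \<eta> < 2 * pi" using d(1) pi_gt_zero by (auto simp: \<eta>_def min_def)
  let ?I = "{\<theta> - \<eta>..\<theta> + \<eta>}"
  have inj: "inj_on (circ c r) ?I"
    using \<eta>(3) by (intro inj_onI circ_inj_near[OF assms(2), of c]) auto
  have sub: "circ c r ` ?I \<subseteq> sphere c r \<inter> frontier (ball_inter K r)"
  proof clarify
    fix s assume s: "s \<in> ?I"
    have sph: "circ c r s \<in> sphere c r" by (rule circ_in_sphere[OF assms(2)])
    have "\<forall>c'\<in>K - {c}. dist (circ c r s) c' < r" using s \<eta>(2) by (intro d(2)) (auto simp: dist_real_def)
    moreover have "dist (circ c r s) c \<le> r" using sph by (simp add: dist_commute)
    ultimately have "dist (circ c r s) c' \<le> r" if "c' \<in> K" for c'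
      using that by (cases "c' = c") (auto intro: less_imp_le)
    then have "circ c r s \<in> ball_inter K r" by (simp add: ball_inter_def dist_commute)
    then show "circ c r s \<in> sphere c r \<inter> frontier (ball_inter K r)"
      using sphere_point_in_frontier[OF ball_inter_subset_cball[OF cK] _ sph assms(2)] sph by blast
  qed
  have "circ c r ` ?I \<subseteq> A"
  proof (rule components_maximal[OF comp _ sub])
    show "connected (circ c r ` ?I)"
      by (intro connected_continuous_image continuous_circ) auto
    show "A \<inter> circ c r ` ?I \<noteq> {}" using \<open>x \<in> A\<close> \<theta> \<eta>(1) by auto
  qed
  from assms(4) consider "A = {x}" | g where "arc g" "path_image g = A" "x = pathstart g \<or> x = pathfinish g"
    by (auto simp: endpoints_def)
  then show False
  proof cases
    case 1
    have "circ c r (\<theta> - \<eta>) \<in> A" using \<open>circ c r ` ?I \<subseteq> A\<close> \<eta>(1) by auto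
    then have "circ c r (\<theta> - \<eta>) = circ c r \<theta>" using 1 \<theta> by simp
    then show False using inj_onD[OF inj, of "\<theta> - \<eta>" \<theta>] \<eta>(1) by auto
  next
    case 2
    obtain k where k: "homeomorphism {0..1} A g k" using homeomorphism_arc[OF 2(1)] 2(2) by metis
    have kA: "k ` A = {0..1}" "continuous_on A k" "\<And>y. y \<in> A \<Longrightarrow> g (k y) = y" "\<And>t. t \<in> {0..1} \<Longrightarrow> k (g t) = t"
      using k by (auto simp: homeomorphism_def)
    have "continuous_on ?I (k \<circ> circ c r)"
      using continuous_on_subset[OF kA(2) \<open>circ c r ` ?I \<subseteq> A\<close>] by (intro continuous_on_compose continuous_circ)
    moreover have "inj_on (k \<circ> circ c r) ?I"
    proof (rule comp_inj_on[OF inj])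
      have "inj_on k A" using kA(3) by (metis inj_onI)
      then show "inj_on k (circ c r ` ?I)" using \<open>circ c r ` ?I \<subseteq> A\<close> by (rule inj_on_subset)
    qed
    ultimately have mono: "k (circ c r (\<theta> - \<eta>)) < k x \<and> k x < k (circ c r (\<theta> + \<eta>)) \<or>
        k (circ c r (\<theta> + \<eta>)) < k x \<and> k x < k (circ c r (\<theta> - \<eta>))"
      using continuous_inj_imp_mono[of "\<theta> - \<eta>" \<theta> "\<theta> + \<eta>" "k \<circ> circ c r"] \<eta>(1) \<theta> by auto
    have "circ c r (\<theta> - \<eta>) \<in> A" "circ c r (\<theta> + \<eta>) \<in> A" using \<open>circ c r ` ?I \<subseteq> A\<close> \<eta>(1) by auto
    then have "k (circ c r (\<theta> - \<eta>)) \<in> {0..1}" "k (circ c r (\<theta> + \<eta>)) \<in> {0..1}" using kA(1) by auto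
    moreover have "k x = 0 \<or> k x = 1" using 2(3) kA(4) by (auto simp: pathstart_def pathfinish_def)
    ultimately show False using mono by auto
  qed
qed

end


text \<open>
  A point \<open>y\<close> other than \<open>c\<close> is excluded by the disc that has \<open>c\<close> on its boundary and its center on the
  far side of \<open>c\<close> as seen from \<open>y\<close>.
\<close>
lemma ball_hull_singleton:
  fixes c :: "'a::real_normed_vector"
  assumes "r > 0"
  shows "ball_hull {c} r = {c}"
proof -
  have "y = c" if "y \<in> ball_hull {c} r" for y
  proof (rule ccontr)
    assume "y \<noteq> c"
    define z where "z = c - (r / norm (y - c)) *\<^sub>R (y - c)"
    have "{c} \<subseteq> cball z r" using assms \<open>y \<noteq> c\<close> by (simp add: z_def dist_norm)
    then have "y \<in> cball z r" using that ball_hull_subset_cball by blast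
    moreover have "y - z = (1 + r / norm (y - c)) *\<^sub>R (y - c)" by (simp add: z_def algebra_simps)
    then have "norm (y - z) = (1 + r / norm (y - c)) * norm (y - c)" using assms by simp
    then have "norm (y - z) = norm (y - c) + r" using \<open>y \<noteq> c\<close> by (simp add: distrib_right)
    ultimately show False using \<open>y \<noteq> c\<close> by (simp add: dist_norm norm_minus_commute)
  qed
  then show ?thesis using subset_ball_hull[of "{c}" r] by blast
qed

text \<open>
  In a parametrization by \<open>{0..1}\<close> the subset becomes a connected set of reals containing 0 and 1.
\<close>
lemma connected_subset_of_arc_with_ends:
  fixes g :: "real \<Rightarrow> 'a::t2_space"
  assumes "arc g" "connected T" "T \<subseteq> path_image g" "pathstart g \<in> T" "pathfinish g \<in> T"
  shows "T = path_image g"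
proof -
  obtain k where "homeomorphism {0..1} (path_image g) g k" using homeomorphism_arc[OF assms(1)] by blast
  then have k: "continuous_on (path_image g) k" "\<And>y. y \<in> path_image g \<Longrightarrow> g (k y) = y"
    "\<And>t. t \<in> {0..1} \<Longrightarrow> k (g t) = t"
    by (auto simp: homeomorphism_def)
  have "connected (k ` T)" using assms(2) continuous_on_subset[OF k(1) assms(3)] by (rule connected_continuous_image[rotated])
  moreover have "0 \<in> k ` T" "1 \<in> k ` T"
    using assms(4,5) k(3)[of 0] k(3)[of 1] by (auto simp: pathstart_def pathfinish_def image_iff intro!: bexI)
  ultimately have "{0..1} \<subseteq> k ` T" by (rule connected_contains_Icc)
  then have "g ` {0..1} \<subseteq> g ` k ` T" by (rule image_mono)
  also have "g ` k ` T = T" using k(2) assms(3) by (force simp: image_image)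
  finally show ?thesis using assms(3) by (auto simp: path_image_def)
qed

context coordinatized_plane
begin

text \<open>
  For a one-point set the ball hull degenerates to that point, which is its own arc for
  every center at distance \<open>r\<close>.
\<close>
lemma singleton_bh_vertex:
  fixes c :: 'a
  assumes "r > 0"
  shows "c \<in> bh_vertices {c} r"
proof -
  define x where "x = circ c r 0"
  have "x \<in> sphere c r" unfolding x_def by (rule circ_in_sphere[OF assms])
  then have c: "c \<in> sphere x r" by (simp add: dist_commute)
  then have sub: "{c} \<subseteq> cball x r" by auto
  have "c \<in> frontier {c}" by (rule sphere_point_in_frontier[OF sub _ c assms]) simp
  then have fr: "frontier (ball_hull {c} r) = {c}"
    unfolding ball_hull_singleton[OF assms] using frontier_subset_closed[of "{c}"] by auto
  have "{c} \<in> bh_subarcs {c} r x"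
    unfolding bh_subarcs_def using sub c fr by auto
  moreover have "B = {c}" if "B \<in> bh_subarcs {c} r x" "{c} \<subseteq> B" for B
    using that fr by (auto simp: bh_subarcs_def)
  ultimately have "{c} \<in> bh_arcs {c} r x" by (auto simp: bh_arcs_def)
  moreover have "c \<in> endpoints {c}" by (auto simp: endpoints_def)
  ultimately show ?thesis unfolding bh_vertices_def by blast
qed

text \<open>
  Cutting the circle at a point outside \<open>A\<close> turns \<open>A\<close> into a compact connected set of angles.
\<close>
lemma connected_proper_part_of_sphere:
  fixes c :: 'a
  assumes "r > 0" "closed A" "connected A" "A \<noteq> {}" "A \<subseteq> sphere c r" "A \<noteq> sphere c r"
  obtains \<alpha> \<beta> where "\<alpha> \<le> \<beta>" "\<beta> < \<alpha> + 2 * pi" "A = circ c r ` {\<alpha>..\<beta>}"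
proof -
  obtain z where z: "z \<in> sphere c r" "z \<notin> A" using assms(5,6) by blast
  obtain t where t: "z = circ c r t" using circ_angle[OF z(1) assms(1)] by blast
  have t': "circ c r (t + 2 * pi) = z"
    unfolding t circ_eq_iff[OF assms(1)] by (intro exI[of _ 1]) simp
  define T where "T = {t..t + 2 * pi} \<inter> circ c r -` A"
  have "closed (circ c r -` A)"
    using assms(2) continuous_circ by (rule closed_vimage)
  then have "compact T" unfolding T_def by (intro compact_Int_closed) auto
  have T: "T \<subseteq> {t<..<t + 2 * pi}"
  proof
    fix s assume "s \<in> T"
    then have s: "s \<in> {t..t + 2 * pi}" "circ c r s \<in> A" by (auto simp: T_def)
    then have "s \<noteq> t" "s \<noteq> t + 2 * pi" using z(2) t t' by auto
    then show "s \<in> {t<..<t + 2 * pi}" using s(1) by auto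
  qed
  have im: "circ c r ` T = A"
  proof
    show "A \<subseteq> circ c r ` T"
    proof
      fix y assume y: "y \<in> A"
      then have "y \<in> sphere c r" using assms(5) by blast
      then obtain s where "t \<le> s" "s < t + 2 * pi" "y = circ c r s" by (rule circ_angle[OF _ assms(1)])
      then show "y \<in> circ c r ` T" using y by (auto simp: T_def)
    qed
  qed (auto simp: T_def)
  have "inj_on (circ c r) T"
  proof (rule inj_onI)
    fix s s' assume s: "s \<in> T" "s' \<in> T" "circ c r s = circ c r s'"
    then have "s \<in> {t<..<t + 2 * pi}" "s' \<in> {t<..<t + 2 * pi}" using T by blast+
    then show "s = s'" by (intro circ_inj_near[OF assms(1) s(3)]) auto
  qed
  then obtain k where k: "homeomorphism T A (circ c r) k"
    using homeomorphism_compact[OF \<open>compact T\<close> continuous_circ im] by blast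
  then have "k ` A = T" "continuous_on A k" by (auto simp: homeomorphism_def)
  then have "connected T" using connected_continuous_image assms(3) by metis
  then obtain \<alpha> \<beta> where ab: "T = {\<alpha>..\<beta>}"
    using \<open>compact T\<close> connected_compact_interval_1[of T] by auto
  moreover have "T \<noteq> {}" using im assms(4) by blast
  ultimately have "\<alpha> \<in> T" "\<beta> \<in> T" "\<alpha> \<le> \<beta>" by auto
  then show ?thesis using that[of \<alpha> \<beta>] T im ab by fastforce
qed

section \<open>Centers of the arcs of the ball intersection\<close>

text \<open>
  Since \<open>H\<close> lies in the disc around \<open>x1\<close>, the functional \<open>f\<close> is at most \<open>f c\<close> on \<open>H\<close>. As \<open>c\<close> is inside an
  arc of \<open>H\<close> with center \<open>x2\<close>, this gives \<open>\<bar>f (c - x2)\<bar> = r\<close>.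
  
  The wrong sign is excluded as follows. It would force \<open>f\<close> to be constant on \<open>H\<close>, and by
  connectedness some \<open>x \<in> A\<close> would satisfy \<open>f (c - x) = 0\<close>. A functional \<open>h\<close> attaining its norm at \<open>c - x\<close> is
  again maximal on \<open>H\<close> at \<open>c\<close>, and this persists after adding a multiple of \<open>f\<close>. A suitable multiple makes
  the sum vanish at \<open>c - x2\<close>, so that by extremality the sum is at most 0 on the whole circle, although
  it is \<open>r\<close> at \<open>c - x\<close>.
\<close>
lemma support_functional_shared_by_arc_end:
  fixes c :: 'a and f :: "'a \<Rightarrow> real"
  assumes "r > 0" "arc g" "path_image g \<subseteq> sphere x2 r" "path_image g \<subseteq> ball_hull K r"
    and "c \<in> path_image g" "c \<notin> {pathstart g, pathfinish g}"
    and "connected A" "A \<subseteq> sphere c r \<inter> ball_inter K r" "x1 \<in> A" "x2 \<in> A"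
    and "linear f" "\<And>z. f z \<le> norm z" "f (c - x1) = r"
  shows "f (c - x2) = r"
proof (rule ccontr)
  assume ne: "f (c - x2) \<noteq> r"
  have nA: "norm (c - x) = r" if "x \<in> A" for x using assms(8) that by (auto simp: dist_norm)
  have hull: "norm (y - x) \<le> r" if "y \<in> path_image g" "x \<in> A" for x y
  proof -
    have "x \<in> ball_inter K r" using assms(8) that(2) by blast
    then have "K \<subseteq> cball x r" by (simp only: ball_inter_iff)
    then have "y \<in> cball x r" using ball_hull_subset_cball assms(4) that(1) by blast
    then show ?thesis by (simp add: dist_norm norm_minus_commute)
  qed
  have top: "h y \<le> h c"
    if "linear h" "\<And>z. h z \<le> norm z" "h (c - x) = r" "x \<in> A" "y \<in> path_image g" for h :: "'a \<Rightarrow> real" and x y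
    using that(2)[of "y - x"] that(3) hull[OF that(5,4)] by (simp add: linear_diff[OF that(1)])
  have "f (c - x1) \<le> \<bar>f (c - x2)\<bar>"
    by (rule functional_extremal_inside_arc[OF assms(2,3,1,5,6,11) _ nA[OF assms(9)]])
       (rule top[OF assms(11,12,13,9)])
  then have opp: "f (c - x2) = - r" using ne assms(12)[of "c - x2"] assms(12)[of "x2 - c"]
      nA[OF assms(10)] assms(13)
    by (simp add: linear_diff[OF assms(11)] norm_minus_commute)
  have const: "f y = f c" if "y \<in> path_image g" for y
  proof (rule antisym)
    show "f y \<le> f c" by (rule top[OF assms(11,12,13,9) that])
    show "f c \<le> f y"
      using assms(12)[of "x2 - y"] hull[OF that assms(10)] opp
      by (simp add: linear_diff[OF assms(11)] norm_minus_commute)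
  qed
  have "connected (f ` A)"
    by (intro connected_continuous_image linear_functional_continuous assms(7,11))
  moreover have "f x1 \<in> f ` A" "f x2 \<in> f ` A" using assms(9,10) by auto
  ultimately have "{f x1..f x2} \<subseteq> f ` A" by (rule connected_contains_Icc)
  moreover have "f c \<in> {f x1..f x2}"
    using assms(1,13) opp by (simp add: linear_diff[OF assms(11)])
  ultimately obtain x where x: "x \<in> A" "f x = f c" by (metis imageE subsetD)
  have "c - x \<noteq> 0" using nA[OF x(1)] assms(1) by auto
  then obtain h :: "'a \<Rightarrow> real" where h: "linear h" "h (c - x) = norm (c - x)" "\<And>z. h z \<le> norm z"
    using support_functional by blast
  define k where "k y = h y + h (c - x2) / r * f y" for y
  have lk: "linear k"
    unfolding k_def by (intro linearI) (simp_all add: linear_add[OF assms(11)] linear_scale[OF assms(11)]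
        linear_add[OF h(1)] linear_scale[OF h(1)] algebra_simps add_divide_distrib)
  have "k y \<le> k c" if "y \<in> path_image g" for y
    using top[OF h(1,3) _ x(1) that] h(2) nA[OF x(1)] const[OF that] by (simp add: k_def)
  then have "k (c - x) \<le> \<bar>k (c - x2)\<bar>"
    by (rule functional_extremal_inside_arc[OF assms(2,3,1,5,6) lk _ nA[OF x(1)]])
  moreover have "k (c - x2) = 0" using assms(1) by (simp add: k_def opp)
  moreover have "k (c - x) = r"
    using h(2) nA[OF x(1)] x(2) by (simp add: k_def linear_diff[OF assms(11)])
  ultimately show False using assms(1) by simp
qed

text \<open>
  The vertex is the last point \<open>v\<close> of \<open>K\<close>, in the direction \<open>e = x2 - x1\<close>, on the line
  where \<open>f\<close> has the value \<open>f c\<close>. Suppose that it is not an end of a maximal arc with center \<open>x2\<close>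
  through \<open>v\<close>. Walk from \<open>v\<close> in steps of \<open>e\<close> until the hull is left for the first time, at \<open>w\<close>. The last
  point before \<open>w\<close> is in the hull, hence within distance \<open>r\<close> of \<open>x1\<close>; so \<open>w\<close> is within distance \<open>r\<close> of
  \<open>x2 = x1 + e\<close>, and since \<open>f\<close> is constant on the walk, the whole segment from \<open>v\<close> to \<open>w\<close> lies on the circle
  around \<open>x2\<close>. It leaves the arc, so it meets an end of the arc, which is a point of \<open>K\<close> on the
  line beyond \<open>v\<close>: a contradiction.
\<close>
lemma vertex_on_supporting_line:
  fixes c :: 'a and f :: "'a \<Rightarrow> real"
  assumes "finite K" "r > 0" "strictly_convex_space TYPE('a) \<or> r \<ge> diameter K"
    and "K \<subseteq> cball x1 r" "K \<subseteq> cball x2 r" "x1 \<noteq> x2"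
    and "c \<in> K" "c' \<in> K" "c' \<noteq> c" "c' \<in> sphere x2 r"
    and "linear f" "\<And>z. f z \<le> norm z" "f (c - x1) = r" "f (c - x2) = r"
  shows "\<exists>v\<in>bh_vertices K r. v \<in> K \<and> f v = f c"
proof -
  note lf = linear_add[OF assms(11)] linear_diff[OF assms(11)] linear_scale[OF assms(11)]
  define e where "e = x2 - x1"
  have e: "e \<noteq> 0" "f e = 0" using assms(6,13,14) by (auto simp: e_def lf)
  obtain \<rho> :: "'a \<Rightarrow> real" where \<rho>: "linear \<rho>" "\<rho> e = norm e"
    using support_functional[OF e(1)] by blast
  define S where "S = {k \<in> K. f k = f c}"
  have "finite (\<rho> ` S)" "\<rho> ` S \<noteq> {}" using assms(1,7) by (auto simp: S_def)
  then have "Max (\<rho> ` S) \<in> \<rho> ` S" "\<And>k. k \<in> S \<Longrightarrow> \<rho> k \<le> Max (\<rho> ` S)" by (auto intro: Max_in)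
  then obtain v where v: "v \<in> S" "\<And>k. k \<in> S \<Longrightarrow> \<rho> k \<le> \<rho> v" by auto
  have vK: "v \<in> K" "f v = f c" using v(1) by (auto simp: S_def)
  have on_circle: "z \<in> sphere x2 r" if "f z = f c" "z \<in> cball x2 r" for z
    using that assms(12)[of "z - x2"] assms(14) by (simp add: dist_norm norm_minus_commute lf)
  have vs: "v \<in> sphere x2 r" using vK assms(5) by (intro on_circle) auto
  \<comment> \<open>a partner for \<open>v\<close> on the circle, so that there is an arc through \<open>v\<close> at all\<close>
  obtain c'' where c'': "c'' \<in> K" "v \<noteq> c''" "c'' \<in> sphere x2 r"
  proof (cases "v = c")
    case True
    then show ?thesis using that[of c'] assms(8-10) by simp
  next
    case False
    then show ?thesis using that[of c] assms(5,7) on_circle[of c] by blast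
  qed
  obtain g where g: "path_image g \<in> bh_arcs K r x2" "arc g" "path_image g \<subseteq> sphere x2 r"
    "path_image g \<subseteq> ball_hull K r" "pathstart g \<in> K" "pathfinish g \<in> K" "v \<in> path_image g"
    "{pathstart g, pathfinish g} \<subseteq> bh_vertices K r"
    using maximal_arc_joining_points[OF assms(1-3,5) vK(1) c''(1,2) vs c''(3)] by blast
  have "v \<in> {pathstart g, pathfinish g}"
  proof (rule ccontr)
    assume nv: "v \<notin> {pathstart g, pathfinish g}"
    have in1: "ball_hull K r \<subseteq> cball x1 r" and in2: "ball_hull K r \<subseteq> cball x2 r"
      by (rule ball_hull_subset_cball, rule assms(4,5))+
    have "\<exists>n::nat. v + real n *\<^sub>R e \<notin> ball_hull K r"
    proof -
      obtain n where n: "2 * r < real n * norm e" using reals_Archimedean3[of "norm e"] e(1) by auto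
      have "norm (real n *\<^sub>R e) \<le> norm (v + real n *\<^sub>R e - x2) + norm (v - x2)"
        using norm_triangle_ineq4[of "v + real n *\<^sub>R e - x2" "v - x2"] by simp
      then have "norm (v + real n *\<^sub>R e - x2) > r" using n vs by (simp add: dist_norm norm_minus_commute)
      then have "v + real n *\<^sub>R e \<notin> cball x2 r" by (simp add: dist_norm norm_minus_commute)
      then show ?thesis using in2 by blast
    qed
    then obtain n where n: "v + real n *\<^sub>R e \<notin> ball_hull K r"
      "\<And>m. m < n \<Longrightarrow> v + real m *\<^sub>R e \<in> ball_hull K r"
      using exists_least_iff[of "\<lambda>n. v + real n *\<^sub>R e \<notin> ball_hull K r"] by blast
    have "n \<noteq> 0" using n(1) vK(1) subset_ball_hull[of K r] by (cases n) auto
    define w where "w = v + real n *\<^sub>R e"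
    have "w \<in> cball x2 r"
    proof -
      have "v + real (n - 1) *\<^sub>R e \<in> cball x1 r" using n(2)[of "n - 1"] \<open>n \<noteq> 0\<close> in1 by auto
      moreover have "x2 - w = x1 - (v + real (n - 1) *\<^sub>R e)"
        using \<open>n \<noteq> 0\<close> by (simp add: w_def e_def of_nat_diff algebra_simps)
      ultimately show ?thesis by (simp add: dist_norm)
    qed
    have fl: "f (linepath v w t) = f c" for t
    proof -
      have "linepath v w t = v + (t * real n) *\<^sub>R e" by (simp add: linepath_def w_def algebra_simps)
      then show ?thesis using vK(2) e(2) by (simp add: lf)
    qed
    have "closed_segment v w \<subseteq> cball x2 r"
      using vs \<open>w \<in> cball x2 r\<close> by (intro closed_segment_subset) auto
    then have sph: "path_image (linepath v w) \<subseteq> sphere x2 r"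
      using on_circle[OF fl] by (auto simp: path_image_def linepath_image_01[symmetric] simp del: mem_sphere mem_cball)
    have "linepath v w 0 \<in> path_image g" "linepath v w 1 \<notin> path_image g"
      using g(4,7) n(1) by (auto simp: w_def linepath_0' linepath_1')
    then obtain t where t: "t \<in> {0..1}" "linepath v w t \<in> {pathstart g, pathfinish g}"
      using path_meets_end_of_arc[OF g(2,3) assms(2) path_linepath sph] by blast
    then have "linepath v w t \<in> S" using g(5,6) fl by (auto simp: S_def)
    then have "\<rho> (linepath v w t) \<le> \<rho> v" by (rule v(2))
    moreover have "linepath v w t = v + (t * real n) *\<^sub>R e" by (simp add: linepath_def w_def algebra_simps)
    ultimately have "t * real n * norm e \<le> 0"
      by (simp add: linear_add[OF \<rho>(1)] linear_scale[OF \<rho>(1)] \<rho>(2))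
    then have "t = 0" using t(1) e(1) \<open>n \<noteq> 0\<close> by (auto simp: mult_le_0_iff)
    then show False using t(2) nv by (simp add: linepath_0')
  qed
  then show ?thesis using g(8) vK by blast
qed

lemma bi_vertex_is_center:
  fixes c x :: 'a
  assumes "finite K" "r > 0" "strictly_convex_space TYPE('a) \<or> r \<ge> diameter K"
    and "A \<in> bi_arcs K r c" "x \<in> endpoints A"
  obtains g where "path_image g \<in> bh_arcs K r x" "arc g" "path_image g \<subseteq> sphere x r"
    "path_image g \<subseteq> ball_hull K r" "pathstart g \<in> K" "pathfinish g \<in> K" "c \<in> path_image g"
    "{pathstart g, pathfinish g} \<subseteq> bh_vertices K r"
proof -
  have cK: "c \<in> K" and comp: "A \<in> components (sphere c r \<inter> frontier (ball_inter K r))"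
    using assms(4) by (auto simp: bi_arcs_def split: if_splits)
  have "x \<in> A" using assms(5) by (auto simp: endpoints_def)
  then have x: "x \<in> sphere c r" "x \<in> ball_inter K r"
    using in_components_subset[OF comp] frontier_subset_closed[OF closed_ball_inter[of K r]] by blast+
  obtain c' where c': "c' \<in> K" "c' \<noteq> c" "c' \<in> sphere x r"
    using bi_arc_end_on_two_circles[OF assms(1,2,4,5)] by blast
  have "c \<in> sphere x r" using x(1) by (simp add: dist_commute)
  moreover have "K \<subseteq> cball x r" using x(2) by (simp add: ball_inter_iff)
  ultimately show ?thesis
    using maximal_arc_joining_points[OF assms(1-3) _ cK c'(1) c'(2)[symmetric] _ c'(3)] that by blast
qed

text \<open>
  Either \<open>c\<close> itself is a vertex of the ball hull, or the arc is a single point, or it is a segment and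
  \<open>vertex_on_supporting_line\<close> provides another vertex whose circle contains that segment.
\<close>
lemma bi_arc_centered_at_bh_vertex:
  fixes c :: 'a
  assumes "finite K" "r > 0" "strictly_convex_space TYPE('a) \<or> r \<ge> diameter K"
    and "A \<in> bi_arcs K r c"
  shows "\<exists>v\<in>bh_vertices K r. A \<subseteq> sphere v r"
proof -
  have cK: "c \<in> K" and comp: "A \<in> components (sphere c r \<inter> frontier (ball_inter K r))"
    using assms(4) by (auto simp: bi_arcs_def split: if_splits)
  have frX: "frontier (ball_inter K r) \<subseteq> ball_inter K r"
    by (rule frontier_subset_closed[OF closed_ball_inter])
  have Asub: "A \<subseteq> sphere c r" "A \<subseteq> ball_inter K r"
    using in_components_subset[OF comp] frX by auto
  have conA: "connected A" using comp by (rule in_components_connected)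
  have "sphere c r = cball c r - ball c r" by auto
  then have "closed (sphere c r \<inter> frontier (ball_inter K r))"
    by (simp only: closed_Int closed_Diff closed_cball open_ball frontier_closed)
  then have "closed A" using comp by (rule closed_components)
  have "A \<noteq> {}" using comp by (rule in_components_nonempty)
  show ?thesis
  proof (cases "c \<in> bh_vertices K r")
    case True
    then show ?thesis using Asub(1) by blast
  next
    case cn: False
    \<comment> \<open>a full circle is an arc of the ball intersection only if \<open>K = {c}\<close>, and then \<open>c\<close> is a vertex\<close>
    have "A \<noteq> sphere c r"
    proof
      assume whole: "A = sphere c r"
      have "c' = c" if "c' \<in> K" for c'
      proof (rule ccontr)
        assume "c' \<noteq> c"
        define y where "y = c + (r / norm (c - c')) *\<^sub>R (c - c')"
        have "y \<in> sphere c r" using \<open>c' \<noteq> c\<close> assms(2) by (simp add: y_def dist_norm)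
        then have "y \<in> ball_inter K r" using whole Asub(2) by blast
        then have "norm (y - c') \<le> r" using that by (auto simp: ball_inter_def dist_norm norm_minus_commute)
        moreover have "y - c' = (1 + r / norm (c - c')) *\<^sub>R (c - c')" by (simp add: y_def algebra_simps)
        then have "norm (y - c') = (1 + r / norm (c - c')) * norm (c - c')" using assms(2) by simp
        then have "norm (y - c') = norm (c - c') + r" using \<open>c' \<noteq> c\<close> by (simp add: distrib_right)
        ultimately show False using \<open>c' \<noteq> c\<close> by simp
      qed
      then have "K = {c}" using cK by blast
      then show False using singleton_bh_vertex[OF assms(2)] cn by blast
    qed
    then obtain \<alpha> \<beta> where ab: "\<alpha> \<le> \<beta>" "\<beta> < \<alpha> + 2 * pi" "A = circ c r ` {\<alpha>..\<beta>}"
      using connected_proper_part_of_sphere[OF assms(2) \<open>closed A\<close> conA \<open>A \<noteq> {}\<close> Asub(1)] by blast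
    show ?thesis
    proof (cases "\<alpha> = \<beta>")
      case True
      define a where "a = circ c r \<alpha>"
      have A: "A = {a}" using ab(3) True by (simp add: a_def)
      then have "a \<in> endpoints A" by (simp add: endpoints_def)
      then obtain g where g: "path_image g \<subseteq> sphere a r" "pathstart g \<in> bh_vertices K r"
        using bi_vertex_is_center[OF assms] by (metis insert_subset)
      have "pathstart g \<in> sphere a r" using g(1) pathstart_in_path_image by blast
      then show ?thesis using g(2) A by (intro bexI[of _ "pathstart g"]) (auto simp: dist_commute)
    next
      case False
      define x1 x2 where "x1 = circ c r \<alpha>" and "x2 = circ c r \<beta>"
      let ?k = "circ c r \<circ> linepath \<alpha> \<beta>"
      have arck: "arc ?k" using ab False by (intro arc_circ[OF assms(2)]) auto
      have "path_image ?k = A"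
        using ab(1,3) by (simp add: path_image_compose path_image_linepath closed_segment_eq_real_ivl)
      moreover have ends: "pathstart ?k = x1" "pathfinish ?k = x2"
        by (auto simp: pathstart_compose pathfinish_compose x1_def x2_def)
      ultimately have "x2 \<in> endpoints A" "x1 \<in> A" "x2 \<in> A" 
        using arck pathstart_in_path_image[of ?k] pathfinish_in_path_image[of ?k]
        by (auto simp: endpoints_def)
      have "x1 \<noteq> x2" using arc_distinct_ends[OF arck] ends by simp
      obtain g where g: "arc g" "path_image g \<subseteq> sphere x2 r" "path_image g \<subseteq> ball_hull K r"
        "c \<in> path_image g" "{pathstart g, pathfinish g} \<subseteq> bh_vertices K r"
        using bi_vertex_is_center[OF assms \<open>x2 \<in> endpoints A\<close>] by metis
      have cg: "c \<notin> {pathstart g, pathfinish g}" using g(5) cn by blast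
      have n1: "norm (c - x1) = r" using Asub(1) \<open>x1 \<in> A\<close> by (auto simp: dist_norm)
      then have "c - x1 \<noteq> 0" using assms(2) by auto
      then obtain f :: "'a \<Rightarrow> real" where f: "linear f" "f (c - x1) = norm (c - x1)" "\<And>z. f z \<le> norm z"
        using support_functional by blast
      have f1: "f (c - x1) = r" using f(2) n1 by simp
      have f2: "f (c - x2) = r"
        using support_functional_shared_by_arc_end[OF assms(2) g(1-4) cg conA _ \<open>x1 \<in> A\<close> \<open>x2 \<in> A\<close> f(1,3) f1]
          Asub by blast
      have X: "K \<subseteq> cball x r" if "x \<in> A" for x
        using Asub(2) that ball_inter_iff[of x K r] by blast
      have seg: "f (c - z) = r" if "z \<in> closed_segment x1 x2" for z
      proof -
        from that obtain u where "z = (1 - u) *\<^sub>R x1 + u *\<^sub>R x2" by (auto simp: closed_segment_def)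
        then have "c - z = (1 - u) *\<^sub>R (c - x1) + u *\<^sub>R (c - x2)" by (simp add: algebra_simps)
        then have "f (c - z) = (1 - u) * r + u * r" using f1 f2 by (simp add: linear_add[OF f(1)] linear_scale[OF f(1)])
        then show ?thesis by (simp add: algebra_simps)
      qed
      have "convex (ball_inter K r)" unfolding ball_inter_def by (intro convex_INT) auto
      then have segX: "closed_segment x1 x2 \<subseteq> ball_inter K r"
        using \<open>x1 \<in> A\<close> \<open>x2 \<in> A\<close> Asub(2) by (intro closed_segment_subset) auto
      have "closed_segment x1 x2 \<subseteq> sphere c r \<inter> frontier (ball_inter K r)"
      proof
        fix z assume z: "z \<in> closed_segment x1 x2"
        then have zX: "z \<in> ball_inter K r" using segX by blast
        then have "norm (c - z) \<le> r" using cK by (auto simp: ball_inter_def dist_norm)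
        then have zs: "z \<in> sphere c r" using f(3)[of "c - z"] seg[OF z] by (simp add: dist_norm)
        then show "z \<in> sphere c r \<inter> frontier (ball_inter K r)"
          using sphere_point_in_frontier[OF ball_inter_subset_cball[OF cK] zX zs assms(2)] by blast
      qed
      then have "closed_segment x1 x2 \<subseteq> A"
        using \<open>x1 \<in> A\<close> by (intro components_maximal[OF comp]) auto
      then have "closed_segment x1 x2 = A"
        using connected_subset_of_arc_with_ends[OF arck, of "closed_segment x1 x2"] ends \<open>path_image ?k = A\<close> by simp
      obtain c' where c': "c' \<in> K" "c' \<noteq> c" "c' \<in> sphere x2 r"
        using bi_arc_end_on_two_circles[OF assms(1,2,4) \<open>x2 \<in> endpoints A\<close>] by blast
      obtain v where v: "v \<in> bh_vertices K r" "v \<in> K" "f v = f c"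
        using vertex_on_supporting_line[OF assms(1-3) X[OF \<open>x1 \<in> A\<close>] X[OF \<open>x2 \<in> A\<close>] \<open>x1 \<noteq> x2\<close> cK c' f(1,3) f1 f2]
        by blast
      have "A \<subseteq> sphere v r"
      proof
        fix z assume "z \<in> A"
        then have "f (v - z) = r" using seg \<open>closed_segment x1 x2 = A\<close> v(3) by (simp add: linear_diff[OF f(1)])
        moreover have "norm (v - z) \<le> r" using X[OF \<open>z \<in> A\<close>] v(2) by (auto simp: dist_norm norm_minus_commute)
        ultimately show "z \<in> sphere v r" using f(3)[of "v - z"] by (simp add: dist_norm)
      qed
      then show ?thesis using v(1) by blast
    qed
  qed
qed

end

theorem theorem2:
  fixes K :: "'a::real_normed_vector set" and r :: real
  assumes "dim (UNIV :: 'a set) = 2"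
    and "finite K" and "K \<noteq> {}"
    and "r > 0" and "r \<ge> circumradius K"
    and "strictly_convex_space TYPE('a) \<or> r \<ge> diameter K"
  shows "(\<forall>c. \<forall>A\<in>bi_arcs K r c. \<exists>v\<in>bh_vertices K r. A \<subseteq> sphere v r) \<and>
         (\<forall>x\<in>bi_vertices K r. \<exists>A. A \<in> bh_arcs K r x)"
proof -
  obtain \<phi> :: "complex \<Rightarrow> 'a" where "linear \<phi>" "bij \<phi>"
    using plane_coordinates_exist[OF assms(1)] by blast
  then interpret coordinatized_plane \<phi> by (rule coordinatized_plane.intro)
  show ?thesis
  proof (intro conjI allI ballI)
    show "\<exists>v\<in>bh_vertices K r. A \<subseteq> sphere v r" if "A \<in> bi_arcs K r c" for c A
      using bi_arc_centered_at_bh_vertex[OF assms(2,4,6) that] .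
    show "\<exists>A. A \<in> bh_arcs K r x" if "x \<in> bi_vertices K r" for x
      using that bi_vertex_is_center[OF assms(2,4,6)] unfolding bi_vertices_def by blast
  qed
qed

end
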